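(* There is an absolute constant $C$ such that the following holds. Let $(P,\sigma,\kappa)$ be a normalized continuous orthonormal system with constant $K$, and let $f:\mathbb{R}^+\to\mathbb{C}$ be such that $f(r)\log(2+r)\in L^2(\mathbb{R}^+)$. Then $$\int_{\mathbb{R}}\sup_{t>0}\left|\int_0^t f(r)P(r,k)\,dr\right|^2\frac{d\sigma(k)}{\kappa(k)}\le C\left(\|\kappa^{-1}\|_{L^\infty(\mathbb{R})}+K\right)\int_0^\infty|f(r)|^2\log^2(2+r)\,dr .$$ Moreover, as $R\to\infty$, $$\int_0^R f(r)P(r,k)\,dr\to\int_0^\infty f(r)P(r,k)\,dr$$ for $\sigma$-a.e. $k\in\mathbb{R}$.
   Context: $\mathbb{R}^+=[0,\infty)$. $L^2_{\rm loc}(\mathbb{R}^+)$ is the set of $g$ with $\int_0^a|g(r)|^2dr<\infty$ for all $a>0$. A pair $(P,\sigma)$, consisting of a (jointly measurable) function $P(r,k):\mathbb{R}^+\times\mathbb{R}\to\mathbb{C}$ and a (Borel) measure $\sigma$ on $\mathbb{R}$, is called a continuous orthonormal system if (a) for $\sigma$-a.e. $k\in\mathbb{R}$, the function $r\mapsto P(r,k)$ belongs to $L^2_{\rm loc}(\mathbb{R}^+)$; (b) for every $f\in L^2(\mathbb{R}^+)$ and every $a>0$, $$\int_{\mathbb{R}}\left|\int_0^a f(r)P(r,k)\,dr\right|^2d\sigma(k)=\int_0^a|f(r)|^2dr .$$ The system is called normalized (and written $(P,\sigma,\kappa)$) if $\kappa$ is a continuous positive function on $\mathbb{R}$ such that $$\kappa^{-1}\in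 L^\infty(\mathbb{R}),\qquad K:=\sup_{r\ge0}\int_{\mathbb{R}}\frac{|P(r,k)|^2}{\kappa(k)}\,d\sigma(k)<\infty .$$ For $f\in L^2(\mathbb{R}^+)$, by (b) the functions $k\mapsto\int_0^R f(r)P(r,k)\,dr$ converge in $L^2_\sigma(\mathbb{R})$ as $R\to\infty$, and $\int_0^\infty f(r)P(r,k)\,dr$ denotes this limit, an element of $L^2_\sigma(\mathbb{R})$. *)

theory Defs
  imports "HOL-Probability.Probability"
begin

text \<open>
  The half-line \<open>[0,\<infinity>)\<close> carries the measure \<open>lebesgue_on {0..}\<close>; the values of functions at
  negative arguments play no role.
\<close>

definition L2 :: "'a measure \<Rightarrow> ('a \<Rightarrow> complex) set" where
  "L2 M = {g \<in> borel_measurable M. (\<integral>\<^sup>+x. ennreal ((cmod (g x))\<^sup>2) \<partial>M) < \<infinity>}"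

definition L2_loc :: "(real \<Rightarrow> complex) set" where
  "L2_loc = {g \<in> borel_measurable (lebesgue_on {0..}).
     \<forall>a>0. (\<integral>\<^sup>+r. ennreal ((cmod (g r))\<^sup>2) \<partial>lebesgue_on {0..a}) < \<infinity>}"

text \<open>
  The integral of \<open>f(r) P(r,k)\<close> over \<open>0 \<le> r \<le> a\<close>. For \<open>f\<close> in \<open>L\<^sup>2\<close> and \<open>P(\<cdot>,k)\<close> in
  \<open>L\<^sup>2\<^sub>l\<^sub>o\<^sub>c\<close> the integrand is integrable; for other \<open>k\<close> the value may be the default \<open>0\<close>, but under
  condition (a) such \<open>k\<close> form a null set.
\<close>

definition trunc_integral ::
    "(real \<Rightarrow> real \<Rightarrow> complex) \<Rightarrow> (real \<Rightarrow> complex) \<Rightarrow> real \<Rightarrow> real \<Rightarrow> complex" where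
  "trunc_integral P f a k = (LINT r|lebesgue_on {0..a}. f r * P r k)"

text \<open>
  No finiteness condition (local finiteness, \<open>\<sigma>\<close>-finiteness) is imposed on the Borel measure
  \<open>\<sigma>\<close>.
\<close>

definition continuous_orthonormal_system ::
    "(real \<Rightarrow> real \<Rightarrow> complex) \<Rightarrow> real measure \<Rightarrow> bool" where
  "continuous_orthonormal_system P \<sigma> \<longleftrightarrow>
     sets \<sigma> = sets borel \<and>
     (\<lambda>(r, k). P r k) \<in> borel_measurable (lebesgue_on {0..} \<Otimes>\<^sub>M \<sigma>) \<and>
     (AE k in \<sigma>. (\<lambda>r. P r k) \<in> L2_loc) \<and>
     (\<forall>f\<in>L2 (lebesgue_on {0..}). \<forall>a>0.
        (\<integral>\<^sup>+k. ennreal ((cmod (trunc_integral P f a k))\<^sup>2) \<partial>\<sigma>)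
          = (\<integral>\<^sup>+r. ennreal ((cmod (f r))\<^sup>2) \<partial>lebesgue_on {0..a}))"

definition Linf_norm :: "(real \<Rightarrow> real) \<Rightarrow> ennreal" where
  "Linf_norm g = esssup lborel (\<lambda>x. ennreal \<bar>g x\<bar>)"

definition system_constant ::
    "(real \<Rightarrow> real \<Rightarrow> complex) \<Rightarrow> real measure \<Rightarrow> (real \<Rightarrow> real) \<Rightarrow> ennreal" where
  "system_constant P \<sigma> \<kappa> = (\<Squnion>r\<in>{0..}. \<integral>\<^sup>+k. ennreal ((cmod (P r k))\<^sup>2 / \<kappa> k) \<partial>\<sigma>)"

definition normalized_continuous_orthonormal_system ::
    "(real \<Rightarrow> real \<Rightarrow> complex) \<Rightarrow> real measure \<Rightarrow> (real \<Rightarrow> real) \<Rightarrow> bool" where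
  "normalized_continuous_orthonormal_system P \<sigma> \<kappa> \<longleftrightarrow>
     continuous_orthonormal_system P \<sigma> \<and>
     continuous_on UNIV \<kappa> \<and> (\<forall>k. 0 < \<kappa> k) \<and>
     Linf_norm (\<lambda>k. 1 / \<kappa> k) < \<infinity> \<and>
     system_constant P \<sigma> \<kappa> < \<infinity>"

text \<open>
  \<open>g\<close> represents the element \<open>\<integral>\<^sub>0\<^sup>\<infinity> f(r) P(r,k) dr\<close> of \<open>L\<^sup>2\<^sub>\<sigma>\<close>, the limit in \<open>L\<^sup>2\<^sub>\<sigma>\<close> of the
  truncated integrals. It is determined up to equality \<open>\<sigma>\<close>-almost everywhere.
\<close>

definition represents_full_integral ::
    "(real \<Rightarrow> real \<Rightarrow> complex) \<Rightarrow> real measure \<Rightarrow> (real \<Rightarrow> complex) \<Rightarrow> (real \<Rightarrow> complex) \<Rightarrow> bool" where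
  "represents_full_integral P \<sigma> f g \<longleftrightarrow>
     g \<in> L2 \<sigma> \<and>
     ((\<lambda>R. \<integral>\<^sup>+k. ennreal ((cmod (trunc_integral P f R k - g k))\<^sup>2) \<partial>\<sigma>) \<longlongrightarrow> 0) at_top"

end

theory Submission
  imports Defs
begin

text \<open>
  Write \<open>T t k\<close> for the integral of \<open>f(r) P(r,k)\<close> over \<open>0 \<le> r \<le> t\<close>. Condition (b) applied to \<open>f\<close> cut off
  to \<open>{s<..t}\<close> shows that \<open>T t - T s\<close> has squared norm \<open>\<integral>\<^sub>s\<^sup>t |f|\<^sup>2\<close> in \<open>L\<^sup>2\<^sub>\<sigma>\<close>. For integer times this is
  all that the Rademacher--Menshov argument needs: split \<open>[1,N]\<close> into dyadic blocks, bound the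
  increments inside a block by the squares over all its dyadic subintervals, and sum the blocks with
  weights \<open>(i + 1)\<^sup>2\<close>, which the squared logarithm absorbs. Between consecutive integers,
  Cauchy--Schwarz bounds \<open>|T t - T n|\<^sup>2\<close> by \<open>\<integral>\<^sub>n\<^sup>n\<^sup>+\<^sup>1 |f|\<^sup>2\<close> times \<open>\<integral>\<^sub>n\<^sup>n\<^sup>+\<^sup>1 |P(r,k)|\<^sup>2 dr\<close>, whose weighted
  \<open>\<sigma>\<close>-integral is at most \<open>K\<close> by Tonelli. Tonelli is legitimate although \<open>\<sigma>\<close> need not be
  \<open>\<sigma>\<close>-finite, because all \<open>T t\<close> vanish almost everywhere outside the \<open>\<sigma>\<close>-finite set on which some
  \<open>T q\<close> with \<open>q\<close> rational is nonzero. Applied to the tails of \<open>f\<close>, the maximal inequality gives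
  convergence almost everywhere.
\<close>

subsection \<open>The Rademacher--Menshov inequality\<close>

text \<open>Sum of the squared increments of \<open>T\<close> over all dyadic subintervals of \<open>[a, a + 2^m]\<close>.\<close>

primrec dyadic_sq :: "nat \<Rightarrow> (nat \<Rightarrow> complex) \<Rightarrow> nat \<Rightarrow> real" where
  "dyadic_sq 0 T a = (cmod (T (a + 1) - T a))\<^sup>2"
| "dyadic_sq (Suc m) T a =
     dyadic_sq m T a + dyadic_sq m T (a + 2 ^ m) + (cmod (T (a + 2 ^ Suc m) - T a))\<^sup>2"

lemma dyadic_sq_nonneg: "0 \<le> dyadic_sq m T a"
  by (induction m arbitrary: a) auto

lemma increment_le_dyadic_sq: "(cmod (T (a + 2 ^ m) - T a))\<^sup>2 \<le> dyadic_sq m T a"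
  by (cases m) (auto simp: dyadic_sq_nonneg add_nonneg_nonneg)

text \<open>Once the triangle inequality is applied, the two sides differ by the square
  \<open>(c |x| - |y|)\<^sup>2 / c\<close>. The free weight \<open>c\<close> lets the dyadic
  induction raise its constant by only one per level; \<open>c = 1\<close> gives the usual factor
  2.\<close>

lemma norm_add_sq_le_weighted:
  fixes x y :: "'a::real_normed_vector"
  assumes "0 < c"
  shows "(norm (x + y))\<^sup>2 \<le> (c + 1) * ((norm x)\<^sup>2 + (norm y)\<^sup>2 / c)"
proof -
  have "(norm (x + y))\<^sup>2 \<le> (norm x + norm y)\<^sup>2"
    by (simp add: norm_triangle_ineq power_mono)
  also have "\<dots> \<le> (norm x + norm y)\<^sup>2 + (c * norm x - norm y)\<^sup>2 / c"
    using assms by simp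
  also have "\<dots> = (c + 1) * ((norm x)\<^sup>2 + (norm y)\<^sup>2 / c)"
    using assms by (simp add: field_simps power2_eq_square)
  finally show ?thesis .
qed

text \<open>Binary expansion splits \<open>[a, a + N]\<close> into at most \<open>m + 1\<close>
  dyadic intervals, and Cauchy-Schwarz over these pieces costs the factor \<open>m + 1\<close>. The
  induction peels off the largest piece.\<close>

lemma increment_le_mult_dyadic_sq:
  assumes "N \<le> 2 ^ m"
  shows "(cmod (T (a + N) - T a))\<^sup>2 \<le> (real m + 1) * dyadic_sq m T a"
  using assms
proof (induction m arbitrary: a N)
  case 0
  then have "N = 0 \<or> N = 1" by auto
  then show ?case by auto
next
  case (Suc m)
  show ?case
  proof (cases "N \<le> 2 ^ m")
    case True
    have "(cmod (T (a + N) - T a))\<^sup>2 \<le> (real m + 1) * dyadic_sq m T a"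
      using Suc.IH[OF True] .
    also have "\<dots> \<le> (real (Suc m) + 1) * dyadic_sq (Suc m) T a"
      by (intro mult_mono) (auto simp: dyadic_sq_nonneg add_nonneg_nonneg)
    finally show ?thesis .
  next
    case False
    define n where "n = N - 2 ^ m"
    have n: "n \<le> 2 ^ m" "a + N = (a + 2 ^ m) + n"
      using False Suc.prems by (auto simp: n_def)
    let ?x = "T (a + 2 ^ m) - T a" and ?y = "T ((a + 2 ^ m) + n) - T (a + 2 ^ m)"
    have "(cmod (T (a + N) - T a))\<^sup>2 = (cmod (?x + ?y))\<^sup>2"
      by (simp add: n)
    \<comment> \<open>The weight \<open>m + 1\<close> cancels the factor that the induction
      hypothesis puts on \<open>?y\<close>, and leaves exactly the factor required at level
      \<open>Suc m\<close>.\<close>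
    also have "\<dots> \<le> ((real m + 1) + 1) * ((cmod ?x)\<^sup>2 + (cmod ?y)\<^sup>2 / (real m + 1))"
      by (rule norm_add_sq_le_weighted) simp
    also have "\<dots> \<le> ((real m + 1) + 1) * (dyadic_sq m T a + dyadic_sq m T (a + 2 ^ m))"
    proof (intro mult_left_mono add_mono increment_le_dyadic_sq)
      show "(cmod ?y)\<^sup>2 / (real m + 1) \<le> dyadic_sq m T (a + 2 ^ m)"
        using Suc.IH[OF n(1), of "a + 2 ^ m"] by (simp add: divide_le_eq mult.commute)
    qed simp
    also have "\<dots> \<le> (real (Suc m) + 1) * dyadic_sq (Suc m) T a"
      by (intro mult_mono) (auto simp: dyadic_sq_nonneg add_nonneg_nonneg)
    finally show ?thesis .
  qed
qed

text \<open>Telescoping: \<open>1 / (j + 1)\<^sup>2 \<le> 1 / j - 1 / (j + 1)\<close>. The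
  subtracted \<open>1 / j\<close> is what makes the induction close; the convention
  \<open>1 / 0 = 0\<close> covers \<open>j = 0\<close>.\<close>

lemma sum_inverse_squares_le: "(\<Sum>i<j. (1 / (real i + 1))\<^sup>2) \<le> 2 - 1 / real j"
proof (induction j)
  case (Suc j)
  show ?case
  proof (cases "j = 0")
    case False
    have "(1 / (real j + 1))\<^sup>2 = 1 / ((real j + 1) * (real j + 1))"
      by (simp add: power2_eq_square)
    also have "\<dots> \<le> 1 / (real j * (real j + 1))"
      using False by (intro divide_left_mono mult_right_mono mult_pos_pos) auto
    also have "\<dots> = 1 / real j - 1 / (real j + 1)"
      using False by (simp add: diff_frac_eq)
    finally have "(1 / (real j + 1))\<^sup>2 \<le> 1 / real j - 1 / (real j + 1)" .
    with Suc show ?thesis by (simp add: add.commute)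
  qed simp
qed simp

text \<open>The cost of the dyadic block from \<open>2 ^ i\<close> to \<open>2 ^ (i + 1)\<close>:
  the first term pays for crossing it completely, the second for stopping inside. The 3 comes from
  splitting a path into three legs, and 6 is 3 times the bound 2 for the sum of inverse
  squares.\<close>

definition block_majorant :: "(nat \<Rightarrow> complex) \<Rightarrow> nat \<Rightarrow> real" where
  "block_majorant T i = 6 * (real i + 1)\<^sup>2 * (cmod (T (2 ^ i + 2 ^ i) - T (2 ^ i)))\<^sup>2
     + 3 * (real i + 1) * dyadic_sq i T (2 ^ i)"

definition rm_majorant :: "(nat \<Rightarrow> complex) \<Rightarrow> ennreal" where
  "rm_majorant T = ennreal (3 * (cmod (T 1))\<^sup>2) + (\<Sum>i. ennreal (block_majorant T i))"

lemma block_majorant_nonneg: "0 \<le> block_majorant T i"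
  by (simp add: block_majorant_def dyadic_sq_nonneg)

lemma norm_add3_sq_le:
  fixes x y z :: "'a::real_normed_vector"
  shows "(norm (x + y + z))\<^sup>2 \<le> 3 * (norm x)\<^sup>2 + 3 * (norm y)\<^sup>2 + 3 * (norm z)\<^sup>2"
proof -
  have "(norm (x + y + z))\<^sup>2 \<le> (norm x + norm y + norm z)\<^sup>2"
    by (intro power_mono norm_triangle_le add_mono norm_triangle_ineq) auto
  also have "\<dots> \<le> (norm x + norm y + norm z)\<^sup>2 + (norm x - norm y)\<^sup>2 + (norm y - norm z)\<^sup>2 + (norm x - norm z)\<^sup>2"
    by simp
  also have "\<dots> = 3 * (norm x)\<^sup>2 + 3 * (norm y)\<^sup>2 + 3 * (norm z)\<^sup>2"
    by (simp add: power2_eq_square algebra_simps)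
  finally show ?thesis .
qed

text \<open>The path to \<open>N\<close> runs to 1, across complete blocks to the largest power
  \<open>2 ^ j \<le> N\<close>, and then inside block \<open>j\<close>. Summing the costs of all
  blocks makes the bound independent of \<open>N\<close>, so it bounds the supremum.\<close>

lemma sq_le_rm_majorant:
  assumes "T 0 = 0"
  shows "ennreal ((cmod (T N))\<^sup>2) \<le> rm_majorant T"
proof (cases "N = 0")
  case True
  with assms show ?thesis by simp
next
  case False
  then obtain j where j: "2 ^ j \<le> N" "N < 2 ^ (j + 1)"
    using ex_power_ivl1[of 2 N] by auto
  define D where "D i = T (2 ^ i + 2 ^ i) - T (2 ^ i)" for i :: nat
  have tele: "T (2 ^ j) - T 1 = (\<Sum>i<j. D i)"
    using sum_lessThan_telescope[of "\<lambda>i. T (2 ^ i)" j] by (simp add: D_def mult_2)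
  have "(cmod (T (2 ^ j) - T 1))\<^sup>2 \<le> (\<Sum>i<j. cmod (D i))\<^sup>2"
    unfolding tele by (intro power_mono norm_sum) auto
  \<comment> \<open>The inserted weights have summable inverse squares, so Cauchy-Schwarz gives a
    constant that does not grow with \<open>j\<close>, at the price of the factor
    \<open>(i + 1)\<^sup>2\<close> on block \<open>i\<close>.\<close>
  also have "\<dots> = (\<Sum>i<j. (1 / (real i + 1)) * ((real i + 1) * cmod (D i)))\<^sup>2"
  proof -
    have "1 / (real i + 1) * ((real i + 1) * x) = x" for i x
      by (simp add: field_simps)
    then show ?thesis by simp
  qed
  also have "\<dots> \<le> (\<Sum>i<j. (1 / (real i + 1))\<^sup>2) * (\<Sum>i<j. ((real i + 1) * cmod (D i))\<^sup>2)"
    by (rule Cauchy_Schwarz_ineq_sum)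
  also have "\<dots> \<le> 2 * (\<Sum>i<j. ((real i + 1) * cmod (D i))\<^sup>2)"
    using sum_inverse_squares_le[of j]
    by (intro mult_right_mono sum_nonneg) (auto intro: order.trans)
  finally have 1: "(cmod (T (2 ^ j) - T 1))\<^sup>2 \<le> 2 * (\<Sum>i<j. ((real i + 1) * cmod (D i))\<^sup>2)" .
  have 2: "(cmod (T N - T (2 ^ j)))\<^sup>2 \<le> (real j + 1) * dyadic_sq j T (2 ^ j)"
    using increment_le_mult_dyadic_sq[of "N - 2 ^ j" j T "2 ^ j"] j by simp
  have "(cmod (T N))\<^sup>2 = (cmod (T 1 + (T (2 ^ j) - T 1) + (T N - T (2 ^ j))))\<^sup>2"
    by simp
  also have "\<dots> \<le> 3 * (cmod (T 1))\<^sup>2 + 3 * (cmod (T (2 ^ j) - T 1))\<^sup>2 + 3 * (cmod (T N - T (2 ^ j)))\<^sup>2"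
    by (rule norm_add3_sq_le)
  also have "\<dots> \<le> 3 * (cmod (T 1))\<^sup>2 + 3 * (2 * (\<Sum>i<j. ((real i + 1) * cmod (D i))\<^sup>2))
      + 3 * ((real j + 1) * dyadic_sq j T (2 ^ j))"
    using 1 2 by (intro add_mono mult_left_mono) auto
  also have "\<dots> = 3 * (cmod (T 1))\<^sup>2 + (\<Sum>i<j. 6 * (real i + 1)\<^sup>2 * (cmod (D i))\<^sup>2)
      + 3 * (real j + 1) * dyadic_sq j T (2 ^ j)"
    by (simp add: sum_distrib_left power_mult_distrib mult.assoc)
  also have "\<dots> \<le> 3 * (cmod (T 1))\<^sup>2 + (\<Sum>i<j. block_majorant T i) + block_majorant T j"
    by (intro add_mono sum_mono) (auto simp: block_majorant_def D_def dyadic_sq_nonneg)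
  also have "\<dots> = 3 * (cmod (T 1))\<^sup>2 + (\<Sum>i<Suc j. block_majorant T i)"
    by simp
  finally have "ennreal ((cmod (T N))\<^sup>2) \<le> ennreal (3 * (cmod (T 1))\<^sup>2 + (\<Sum>i<Suc j. block_majorant T i))"
    by (rule ennreal_leI)
  also have "\<dots> = ennreal (3 * (cmod (T 1))\<^sup>2) + (\<Sum>i<Suc j. ennreal (block_majorant T i))"
    by (subst ennreal_plus) (auto simp: sum_nonneg block_majorant_nonneg sum_ennreal simp del: sum.lessThan_Suc)
  also have "\<dots> \<le> rm_majorant T"
    unfolding rm_majorant_def by (intro add_left_mono sum_le_suminf) auto
  finally show ?thesis .
qed

lemma borel_measurable_dyadic_sq [measurable]:
  assumes [measurable]: "\<And>n. T n \<in> borel_measurable M"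
  shows "(\<lambda>k. dyadic_sq m (\<lambda>n. T n k) a) \<in> borel_measurable M"
  by (induction m arbitrary: a) auto

lemma borel_measurable_rm_majorant [measurable]:
  assumes [measurable]: "\<And>n. T n \<in> borel_measurable M"
  shows "(\<lambda>k. rm_majorant (\<lambda>n. T n k)) \<in> borel_measurable M"
  unfolding rm_majorant_def block_majorant_def by measurable

text \<open>At each of the \<open>m + 1\<close> scales the dyadic intervals of that length tile
  \<open>[a, a + 2 ^ m]\<close>, so by \<open>incr\<close> each scale contributes at most the full
  sum of \<open>A\<close>.\<close>

lemma nn_integral_dyadic_sq_le:
  fixes A :: "nat \<Rightarrow> ennreal"
  assumes [measurable]: "\<And>n. T n \<in> borel_measurable M"
    and incr: "\<And>a b. a \<le> b \<Longrightarrow> (\<integral>\<^sup>+k. ennreal ((cmod (T b k - T a k))\<^sup>2) \<partial>M) \<le> (\<Sum>n\<in>{a..<b}. A n)"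
  shows "(\<integral>\<^sup>+k. ennreal (dyadic_sq m (\<lambda>n. T n k) a) \<partial>M)
    \<le> (of_nat m + 1) * (\<Sum>n\<in>{a..<a + 2 ^ m}. A n)"
proof (induction m arbitrary: a)
  case 0
  show ?case using incr[of a "a + 1"] by simp
next
  case (Suc m)
  let ?X = "\<lambda>k. ennreal (dyadic_sq m (\<lambda>n. T n k) a)"
    and ?Y = "\<lambda>k. ennreal (dyadic_sq m (\<lambda>n. T n k) (a + 2 ^ m))"
    and ?Z = "\<lambda>k. ennreal ((cmod (T (a + 2 ^ Suc m) k - T a k))\<^sup>2)"
    and ?S = "\<Sum>n\<in>{a..<a + 2 ^ Suc m}. A n"
  have "(\<integral>\<^sup>+k. ennreal (dyadic_sq (Suc m) (\<lambda>n. T n k) a) \<partial>M) = (\<integral>\<^sup>+k. ?X k + ?Y k + ?Z k \<partial>M)"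
    by (simp add: dyadic_sq_nonneg)
  also have "\<dots> = (\<integral>\<^sup>+k. ?X k \<partial>M) + (\<integral>\<^sup>+k. ?Y k \<partial>M) + (\<integral>\<^sup>+k. ?Z k \<partial>M)"
    by (subst nn_integral_add; (subst nn_integral_add)?) auto
  also have "\<dots> \<le> (of_nat m + 1) * (\<Sum>n\<in>{a..<a + 2 ^ m}. A n)
      + (of_nat m + 1) * (\<Sum>n\<in>{a + 2 ^ m..<a + 2 ^ m + 2 ^ m}. A n) + ?S"
    by (intro add_mono Suc.IH incr) auto
  also have "\<dots> = (of_nat m + 1) * ((\<Sum>n\<in>{a..<a + 2 ^ m}. A n) + (\<Sum>n\<in>{a + 2 ^ m..<a + 2 ^ m + 2 ^ m}. A n)) + ?S"
    by (simp add: distrib_left)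
  also have "(\<Sum>n\<in>{a..<a + 2 ^ m}. A n) + (\<Sum>n\<in>{a + 2 ^ m..<a + 2 ^ m + 2 ^ m}. A n) = ?S"
    by (subst sum.atLeastLessThan_concat) (auto simp: mult_2 add.assoc)
  also have "(of_nat m + 1) * ?S + ?S = (of_nat (Suc m) + 1) * ?S"
    by (simp add: algebra_simps)
  finally show ?case .
qed

text \<open>This trades block weights for logarithms:
  \<open>2 ^ (i + 1) \<le> (2 + x)\<^sup>2\<close>, and \<open>ln 2 \<ge> 1/2\<close> turns the
  resulting factor 2 into 4.\<close>

lemma le_4_ln:
  assumes "2 ^ i \<le> x"
  shows "real i + 1 \<le> 4 * ln (2 + x)"
proof -
  have x: "1 \<le> x" using assms by (meson one_le_power one_le_numeral order_trans)
  have "(2::real) ^ (i + 1) \<le> (2 + x)\<^sup>2"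
    using assms x by (simp add: power2_eq_square algebra_simps) (smt (verit) mult_nonneg_nonneg)
  then have "ln ((2::real) ^ (i + 1)) \<le> ln ((2 + x)\<^sup>2)"
    using x by (subst ln_le_cancel_iff) auto
  then have *: "(real i + 1) * ln 2 \<le> 2 * ln (2 + x)"
    using x by (simp add: ln_realpow ln_mult algebra_simps)
  have "(real i + 1) * (1 / 2) \<le> (real i + 1) * ln 2"
    using ln2_ge_two_thirds by (intro mult_left_mono) auto
  from order_trans[OF this *] show ?thesis by simp
qed

text \<open>A block has about \<open>i\<close> dyadic scales, so both terms of its majorant cost a
  multiple of \<open>(i + 1)\<^sup>2\<close>, in total \<open>6 + 3 = 9\<close>. Comparing
  \<open>(i + 1)\<^sup>2\<close> with the squared logarithm costs \<open>4\<^sup>2 = 16\<close>,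
  whence 144.\<close>

lemma rm_majorant_bound:
  fixes A :: "nat \<Rightarrow> ennreal"
  assumes [measurable]: "\<And>n. T n \<in> borel_measurable M"
    and T0: "\<And>k. k \<in> space M \<Longrightarrow> T 0 k = 0"
    and incr: "\<And>a b. a \<le> b \<Longrightarrow> (\<integral>\<^sup>+k. ennreal ((cmod (T b k - T a k))\<^sup>2) \<partial>M) \<le> (\<Sum>n\<in>{a..<b}. A n)"
  shows "(\<integral>\<^sup>+k. rm_majorant (\<lambda>n. T n k) \<partial>M) \<le> 144 * (\<Sum>n. A n * ennreal ((ln (2 + real n))\<^sup>2))"
proof -
  define w where "w n = A n * ennreal ((ln (2 + real n))\<^sup>2)" for n
  \<comment> \<open>The alternative \<open>i = 0\<close> admits \<open>n = 0\<close>, which belongs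
    to no dyadic block and carries the increment from \<open>T 0\<close> to
    \<open>T 1\<close>.\<close>
  have w_ge: "ennreal ((real i + 1)\<^sup>2) * A n \<le> 16 * w n" if "2 ^ i \<le> n \<or> i = 0" for i n
  proof -
    have "real i + 1 \<le> 4 * ln (2 + real n)"
    proof (cases "2 ^ i \<le> n")
      case True
      then have "2 ^ i \<le> real n" by (metis of_nat_le_iff of_nat_numeral of_nat_power)
      then show ?thesis by (rule le_4_ln)
    next
      case False
      with that have "i = 0" "n = 0" by auto
      then show ?thesis using ln2_ge_two_thirds by simp
    qed
    then have "(real i + 1)\<^sup>2 \<le> 16 * (ln (2 + real n))\<^sup>2"
      using power_mono[of "real i + 1" "4 * ln (2 + real n)" 2] by (simp add: power_mult_distrib)
    then have "ennreal ((real i + 1)\<^sup>2) \<le> 16 * ennreal ((ln (2 + real n))\<^sup>2)"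
      by (metis ennreal_leI ennreal_mult' ennreal_numeral zero_le_numeral)
    then have "ennreal ((real i + 1)\<^sup>2) * A n \<le> (16 * ennreal ((ln (2 + real n))\<^sup>2)) * A n"
      by (rule mult_right_mono) simp
    then show ?thesis by (simp add: w_def mult_ac)
  qed
  have block: "(\<integral>\<^sup>+k. ennreal (block_majorant (\<lambda>n. T n k) i) \<partial>M) \<le> 144 * (\<Sum>n\<in>{2 ^ i..<2 ^ Suc i}. w n)" for i
  proof -
    let ?S = "\<Sum>n\<in>{2 ^ i..<2 ^ i + 2 ^ i}. A n"
    have "(\<integral>\<^sup>+k. ennreal (block_majorant (\<lambda>n. T n k) i) \<partial>M) =
      (\<integral>\<^sup>+k. ennreal (6 * (real i + 1)\<^sup>2) * ennreal ((cmod (T (2 ^ i + 2 ^ i) k - T (2 ^ i) k))\<^sup>2)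
       + ennreal (3 * (real i + 1)) * ennreal (dyadic_sq i (\<lambda>n. T n k) (2 ^ i)) \<partial>M)"
      unfolding block_majorant_def
      by (subst ennreal_plus) (auto simp: ennreal_mult dyadic_sq_nonneg)
    also have "\<dots> = ennreal (6 * (real i + 1)\<^sup>2) * (\<integral>\<^sup>+k. ennreal ((cmod (T (2 ^ i + 2 ^ i) k - T (2 ^ i) k))\<^sup>2) \<partial>M)
       + ennreal (3 * (real i + 1)) * (\<integral>\<^sup>+k. ennreal (dyadic_sq i (\<lambda>n. T n k) (2 ^ i)) \<partial>M)"
      by (simp add: nn_integral_add nn_integral_cmult)
    also have "\<dots> \<le> ennreal (6 * (real i + 1)\<^sup>2) * ?S + ennreal (3 * (real i + 1)) * ((of_nat i + 1) * ?S)"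
      by (intro add_mono mult_left_mono nn_integral_dyadic_sq_le incr) auto
    also have "of_nat i + 1 = ennreal (real i + 1)"
      by (simp add: ennreal_of_nat_eq_real_of_nat)
    also have "ennreal (6 * (real i + 1)\<^sup>2) * ?S + ennreal (3 * (real i + 1)) * (ennreal (real i + 1) * ?S)
       = ennreal (6 * (real i + 1)\<^sup>2 + 3 * (real i + 1) * (real i + 1)) * ?S"
      by (simp add: distrib_right ennreal_mult mult.assoc)
    also have "6 * (real i + 1)\<^sup>2 + 3 * (real i + 1) * (real i + 1) = 9 * (real i + 1)\<^sup>2"
      by (simp add: power2_eq_square)
    also have "ennreal (9 * (real i + 1)\<^sup>2) * ?S = 9 * (\<Sum>n\<in>{2 ^ i..<2 ^ i + 2 ^ i}. ennreal ((real i + 1)\<^sup>2) * A n)"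
      by (simp add: ennreal_mult sum_distrib_left mult.assoc)
    also have "\<dots> \<le> 9 * (\<Sum>n\<in>{2 ^ i..<2 ^ i + 2 ^ i}. 16 * w n)"
      by (intro mult_left_mono sum_mono w_ge) auto
    also have "\<dots> = 144 * (\<Sum>n\<in>{2 ^ i..<2 ^ Suc i}. w n)"
      by (simp add: sum_distrib_left mult_2 mult.assoc[symmetric])
    finally show ?thesis .
  qed
  have zero: "(\<integral>\<^sup>+k. ennreal (3 * (cmod (T 1 k))\<^sup>2) \<partial>M) \<le> 144 * w 0"
  proof -
    have "(\<integral>\<^sup>+k. ennreal (3 * (cmod (T 1 k))\<^sup>2) \<partial>M) = 3 * (\<integral>\<^sup>+k. ennreal ((cmod (T 1 k - T 0 k))\<^sup>2) \<partial>M)"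
      by (subst nn_integral_cmult[symmetric]) (auto intro!: nn_integral_cong simp: T0 ennreal_mult)
    also have "\<dots> \<le> 3 * A 0"
      using incr[of 0 1] by (intro mult_left_mono) auto
    also have "\<dots> \<le> 3 * (16 * w 0)"
      using w_ge[of 0 0] by (intro mult_left_mono) auto
    also have "\<dots> = 48 * w 0" by (simp add: mult.assoc[symmetric])
    also have "\<dots> \<le> 144 * w 0" by (intro mult_right_mono) auto
    finally show ?thesis .
  qed
  \<comment> \<open>The index 0 and the dyadic blocks tile the natural numbers, so no
    \<open>w n\<close> is counted twice.\<close>
  have split: "w 0 + (\<Sum>i<J. \<Sum>n\<in>{2 ^ i..<2 ^ Suc i}. w n) = (\<Sum>n<2 ^ J. w n)" for J
  proof (induction J)
    case (Suc J)
    have "(\<Sum>n<2 ^ Suc J. w n) = (\<Sum>n<2 ^ J. w n) + (\<Sum>n\<in>{2 ^ J..<2 ^ Suc J}. w n)"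
      unfolding lessThan_atLeast0 by (subst sum.atLeastLessThan_concat) auto
    then show ?case unfolding Suc[symmetric] by (simp add: add.assoc)
  qed simp
  have "(\<integral>\<^sup>+k. rm_majorant (\<lambda>n. T n k) \<partial>M) =
      (\<integral>\<^sup>+k. ennreal (3 * (cmod (T 1 k))\<^sup>2) \<partial>M) + (\<Sum>i. \<integral>\<^sup>+k. ennreal (block_majorant (\<lambda>n. T n k) i) \<partial>M)"
    unfolding rm_majorant_def block_majorant_def
    by (subst nn_integral_add, measurable, subst nn_integral_suminf) auto
  also have "\<dots> \<le> 144 * w 0 + (\<Sum>i. 144 * (\<Sum>n\<in>{2 ^ i..<2 ^ Suc i}. w n))"
    by (intro add_mono zero suminf_le block) auto
  also have "\<dots> = 144 * (w 0 + (\<Sum>i. (\<Sum>n\<in>{2 ^ i..<2 ^ Suc i}. w n)))"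
    by (simp add: distrib_left ennreal_suminf_cmult)
  also have "w 0 + (\<Sum>i. (\<Sum>n\<in>{2 ^ i..<2 ^ Suc i}. w n)) \<le> (\<Sum>n. w n)"
  proof (rule LIMSEQ_le_const2)
    show "(\<lambda>J. w 0 + (\<Sum>i<J. \<Sum>n\<in>{2 ^ i..<2 ^ Suc i}. w n)) \<longlonglongrightarrow> w 0 + (\<Sum>i. (\<Sum>n\<in>{2 ^ i..<2 ^ Suc i}. w n))"
      by (intro tendsto_add tendsto_const summable_LIMSEQ) auto
    show "\<exists>N. \<forall>J\<ge>N. w 0 + (\<Sum>i<J. \<Sum>n\<in>{2 ^ i..<2 ^ Suc i}. w n) \<le> (\<Sum>n. w n)"
      unfolding split by (auto intro!: sum_le_suminf)
  qed
  finally show ?thesis by (simp add: w_def mult_left_mono)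
qed

subsection \<open>The half-line and truncated integrals\<close>

text \<open>By Markov, each set where \<open>m * u i \<ge> 1\<close> has finite measure; countably
  many of them cover the support, and the density kills the complement. A density, unlike a
  restriction, leaves the space and its measurable sets unchanged.\<close>

lemma sigma_finite_density_support:
  fixes u :: "'i \<Rightarrow> 'a \<Rightarrow> ennreal"
  assumes I: "countable I"
    and u [measurable]: "\<And>i. i \<in> I \<Longrightarrow> u i \<in> borel_measurable M"
    and fin: "\<And>i. i \<in> I \<Longrightarrow> (\<integral>\<^sup>+x. u i x \<partial>M) < \<infinity>"
  shows "sigma_finite_measure (density M (indicator (\<Union>i\<in>I. {x\<in>space M. u i x \<noteq> 0})))"
proof -
  define S where "S = (\<Union>i\<in>I. {x\<in>space M. u i x \<noteq> 0})"
  define B where "B = (\<lambda>(i, m::nat). {x\<in>space M. 1 \<le> of_nat m * u i x})"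
  have S [measurable]: "S \<in> sets M"
    unfolding S_def using I by (intro sets.countable_UN'') measurable
  have B [measurable]: "B p \<in> sets M" if "p \<in> I \<times> UNIV" for p
    using that by (cases p) (auto simp: B_def)
  have "sigma_finite_measure (density M (indicator S))"
  proof
    let ?C = "insert (space M - S) (B ` (I \<times> UNIV))"
    have "\<exists>m::nat. 1 \<le> of_nat m * u i x" if "u i x \<noteq> 0" for i x
    proof (cases "u i x = \<infinity>")
      case True
      then show ?thesis by (intro exI[of _ 1]) simp
    next
      case False
      have "inverse (u i x) < \<infinity>" using that by (simp add: top.not_eq_extremum less_top[symmetric])
      then obtain m where "inverse (u i x) < of_nat m"
        using ennreal_Ex_less_of_nat by auto
      then have "inverse (u i x) * u i x \<le> of_nat m * u i x"
        by (intro mult_right_mono) auto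
      moreover have "inverse (u i x) * u i x = 1"
        using ennreal_divide_self[of "u i x"] that False
        by (simp add: divide_ennreal_def mult.commute less_top)
      ultimately show ?thesis by auto
    qed
    then have "x \<in> \<Union>?C" if "x \<in> space M" for x
      using that by (cases "x \<in> S") (auto simp: S_def B_def Bex_def)
    then have "\<Union>?C = space M"
      by (auto simp: B_def)
    moreover have "emeasure (density M (indicator S)) (B p) \<noteq> \<infinity>" if p: "p \<in> I \<times> UNIV" for p
    proof -
      obtain i m where im: "p = (i, m)" "i \<in> I" using p by auto
      have "emeasure (density M (indicator S)) (B p) = (\<integral>\<^sup>+x. indicator S x * indicator (B p) x \<partial>M)"
        using p by (intro emeasure_density) auto
      also have "\<dots> \<le> (\<integral>\<^sup>+x. of_nat m * u i x \<partial>M)"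
        by (intro nn_integral_mono) (auto simp: B_def im split: split_indicator)
      also have "\<dots> = of_nat m * (\<integral>\<^sup>+x. u i x \<partial>M)"
        using im by (intro nn_integral_cmult) auto
      also have "\<dots> < \<infinity>"
        using fin[OF im(2)] by (simp add: ennreal_mult_less_top of_nat_less_top)
      finally show ?thesis by simp
    qed
    moreover have "emeasure (density M (indicator S)) (space M - S) = 0"
      by (subst emeasure_density) (auto simp: nn_integral_0_iff_AE split: split_indicator)
    ultimately show "\<exists>A. countable A \<and> A \<subseteq> sets (density M (indicator S)) \<and>
        \<Union> A = space (density M (indicator S)) \<and> (\<forall>a\<in>A. emeasure (density M (indicator S)) a \<noteq> \<infinity>)"
      using I B by (intro exI[of _ ?C]) auto
  qed
  then show ?thesis by (simp add: S_def)
qed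

section \<open>Lebesgue measure on the half-line\<close>

abbreviation half_line :: "real measure" where
  "half_line \<equiv> lebesgue_on {0..}"

lemma (in sigma_finite_measure) sigma_finite_completion: "sigma_finite_measure (completion M)"
proof -
  obtain A where "countable A" "A \<subseteq> sets M" "\<Union>A = space M" "\<forall>a\<in>A. emeasure M a \<noteq> \<infinity>"
    using sigma_finite_countable by metis
  then show ?thesis
    by unfold_locales (intro exI[of _ A], auto simp: emeasure_completion)
qed

lemma sigma_finite_half_line: "sigma_finite_measure half_line"
  by (intro sigma_finite_measure_restrict_space lborel.sigma_finite_completion) auto

lemma lebesgue_on_interval: "lebesgue_on {0..a::real} = restrict_space half_line {0..a}"
  by (subst restrict_restrict_space) (auto intro!: arg_cong[where f="restrict_space lebesgue"])

lemma borel_measurable_half_line: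
  "g \<in> borel_measurable borel \<Longrightarrow> g \<in> borel_measurable half_line"
  by (intro measurable_restrict_space1) (auto intro: measurable_completion)

lemma indicator_half_line [measurable]:
  assumes "A \<in> sets borel"
  shows "(indicator A :: real \<Rightarrow> real) \<in> borel_measurable half_line"
    and "(indicator A :: real \<Rightarrow> ennreal) \<in> borel_measurable half_line"
  using assms by (rule borel_measurable_half_line[OF borel_measurable_indicator])+

lemma ident_half_line [measurable]: "(\<lambda>x. x) \<in> borel_measurable half_line"
  by (rule borel_measurable_half_line) simp

lemma interval_in_half_line: "{0..a::real} \<in> sets half_line"
  by (auto simp: sets_restrict_space image_iff intro!: exI[of _ "{0..a}"])

lemma nn_integral_lebesgue_on_interval:
  "(\<integral>\<^sup>+r. g r \<partial>lebesgue_on {0..a::real}) = (\<integral>\<^sup>+r. g r * indicator {0..a} r \<partial>half_line)"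
  unfolding lebesgue_on_interval by (rule nn_integral_restrict_space) (simp add: interval_in_half_line)

section \<open>Truncated integrals as functions of the endpoint\<close>

definition loc_integrable :: "(real \<Rightarrow> complex) \<Rightarrow> bool" where
  "loc_integrable h \<longleftrightarrow> (\<forall>a. integrable half_line (\<lambda>r. indicator {0..a} r *\<^sub>R h r))"

lemma trunc_integral_eq:
  "trunc_integral P f a k = (LINT r|half_line. indicator {0..a} r *\<^sub>R (f r * P r k))"
  unfolding trunc_integral_def lebesgue_on_interval
  by (rule integral_restrict_space) (simp add: interval_in_half_line)

lemma trunc_integral_0: "trunc_integral P f 0 k = 0"
proof -
  have "AE r in half_line. indicator {0..0::real} r *\<^sub>R (f r * P r k) = 0"
  proof -
    have "AE r in lebesgue. r \<noteq> (0::real)"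
      by (intro AE_completion AE_lborel_singleton)
    then have "AE r in half_line. r \<noteq> 0"
      by (subst AE_restrict_space_iff) auto
    then show ?thesis by eventually_elim auto
  qed
  then show ?thesis
    unfolding trunc_integral_eq by (rule integral_eq_zero_AE)
qed

lemma loc_integrable_mult:
  assumes f: "f \<in> L2 half_line" and p: "p \<in> L2_loc"
  shows "loc_integrable (\<lambda>r. f r * p r)"
  unfolding loc_integrable_def
proof
  fix a :: real
  have [measurable]: "f \<in> borel_measurable half_line" "p \<in> borel_measurable half_line"
    using f p by (auto simp: L2_def L2_loc_def)
  \<comment> \<open>\<open>L2_loc\<close> speaks only of positive endpoints, while \<open>a\<close>
    is arbitrary.\<close>
  define b where "b = max a 1"
  show "integrable half_line (\<lambda>r. indicator {0..a} r *\<^sub>R (f r * p r))"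
  proof (rule integrableI_bounded)
    have "(\<integral>\<^sup>+r. ennreal (norm (indicator {0..a} r *\<^sub>R (f r * p r))) \<partial>half_line)
      \<le> (\<integral>\<^sup>+r. ennreal ((cmod (f r))\<^sup>2) + ennreal ((cmod (p r))\<^sup>2) * indicator {0..b} r \<partial>half_line)"
    proof (intro nn_integral_mono)
      fix r
      have "0 \<le> (cmod (f r) - cmod (p r))\<^sup>2" by simp
      then have "2 * (cmod (f r) * cmod (p r)) \<le> (cmod (f r))\<^sup>2 + (cmod (p r))\<^sup>2"
        unfolding power2_diff by simp
      then have "cmod (f r) * cmod (p r) \<le> (cmod (f r))\<^sup>2 + (cmod (p r))\<^sup>2"
        using mult_nonneg_nonneg[of "cmod (f r)" "cmod (p r)"] norm_ge_zero by (smt (verit))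
      then show "ennreal (norm (indicator {0..a} r *\<^sub>R (f r * p r)))
          \<le> ennreal ((cmod (f r))\<^sup>2) + ennreal ((cmod (p r))\<^sup>2) * indicator {0..b} r"
        by (auto simp: norm_mult b_def ennreal_plus[symmetric] simp del: ennreal_plus split: split_indicator intro!: ennreal_leI)
    qed
    also have "\<dots> = (\<integral>\<^sup>+r. ennreal ((cmod (f r))\<^sup>2) \<partial>half_line)
        + (\<integral>\<^sup>+r. ennreal ((cmod (p r))\<^sup>2) \<partial>lebesgue_on {0..b})"
      unfolding nn_integral_lebesgue_on_interval by (intro nn_integral_add) measurable
    also have "\<dots> < \<infinity>"
      using f p by (auto simp: L2_def L2_loc_def b_def)
    finally show "(\<integral>\<^sup>+r. ennreal (norm (indicator {0..a} r *\<^sub>R (f r * p r))) \<partial>half_line) < \<infinity>" .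
  qed measurable
qed

lemma trunc_integral_diff:
  assumes "loc_integrable (\<lambda>r. f r * P r k)" "0 \<le> s" "s \<le> t"
  shows "integrable half_line (\<lambda>r. indicator {s<..t} r *\<^sub>R (f r * P r k))"
    and "trunc_integral P f t k - trunc_integral P f s k
      = (LINT r|half_line. indicator {s<..t} r *\<^sub>R (f r * P r k))"
proof -
  let ?h = "\<lambda>a r. indicator {0..a} r *\<^sub>R (f r * P r k)"
  have int: "integrable half_line (?h a)" for a
    using assms(1) by (simp add: loc_integrable_def)
  have eq: "?h t r - ?h s r = indicator {s<..t} r *\<^sub>R (f r * P r k)" for r
    using assms by (auto split: split_indicator)
  show "integrable half_line (\<lambda>r. indicator {s<..t} r *\<^sub>R (f r * P r k))"
    using Bochner_Integration.integrable_diff[OF int int, of t s] by (simp add: eq)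
  show "trunc_integral P f t k - trunc_integral P f s k
      = (LINT r|half_line. indicator {s<..t} r *\<^sub>R (f r * P r k))"
    unfolding trunc_integral_eq
    by (subst Bochner_Integration.integral_diff[OF int int, symmetric]) (simp add: eq)
qed

text \<open>On each \<open>{0..b}\<close> the Lebesgue integral agrees with the gauge integral,
  whose indefinite integral is continuous.\<close>

lemma trunc_integral_continuous:
  assumes "loc_integrable (\<lambda>r. f r * P r k)"
  shows "continuous_on {0..b} (\<lambda>t. trunc_integral P f t k)"
proof -
  have int: "integrable (lebesgue_on {0..a}) (\<lambda>r. f r * P r k)" for a
    using assms unfolding loc_integrable_def lebesgue_on_interval
    by (subst integrable_restrict_space) (auto simp: interval_in_half_line)
  have "trunc_integral P f t k = integral {0..t} (\<lambda>r. f r * P r k)" for t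
    unfolding trunc_integral_def by (intro lebesgue_integral_eq_integral int) auto
  moreover have "(\<lambda>r. f r * P r k) integrable_on {0..b}"
    by (intro integrable_on_lebesgue_on int) auto
  ultimately show ?thesis
    by (simp add: indefinite_integral_continuous_1)
qed

text \<open>A nonzero value would persist on a neighbourhood by continuity and hence at some
  rational. Thus countably many times decide whether all truncated integrals vanish at
  \<open>k\<close>.\<close>

lemma trunc_integral_eq_0_if_rat:
  assumes h: "loc_integrable (\<lambda>r. f r * P r k)"
    and rat: "\<And>q. q \<in> \<rat> \<Longrightarrow> 0 < q \<Longrightarrow> trunc_integral P f q k = 0"
    and t: "0 < t"
  shows "trunc_integral P f t k = 0"
proof (rule ccontr)
  let ?T = "\<lambda>t. trunc_integral P f t k"
  assume "?T t \<noteq> 0"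
  have "continuous_on {0<..<t + 1} ?T"
    by (rule continuous_on_subset[OF trunc_integral_continuous[where b="t + 1"]]) (use h in auto)
  then have "continuous (at t) ?T"
    using t by (simp add: continuous_on_eq_continuous_at)
  from continuous_at_avoid[OF this \<open>?T t \<noteq> 0\<close>]
  obtain e where e: "0 < e" "\<And>y. dist t y < e \<Longrightarrow> ?T y \<noteq> 0" by auto
  obtain q where "q \<in> \<rat>" "t < q" "q < t + e"
    using Rats_dense_in_real[of t "t + e"] e(1) by auto
  with e(2)[of q] rat[of q] t show False by (auto simp: dist_real_def)
qed

text \<open>Cauchy-Schwarz at a fixed \<open>k\<close>. Enlarging \<open>{s<..t}\<close> to a unit
  cell later makes the right side independent of \<open>t\<close>, which controls the uncountably
  many times between two integers.\<close>

lemma trunc_integral_diff_sq_le: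
  assumes h: "loc_integrable (\<lambda>r. f r * P r k)" and st: "0 \<le> s" "s \<le> t"
    and [measurable]: "f \<in> borel_measurable half_line" "(\<lambda>r. P r k) \<in> borel_measurable half_line"
  shows "ennreal ((cmod (trunc_integral P f t k - trunc_integral P f s k))\<^sup>2)
    \<le> (\<integral>\<^sup>+r. ennreal ((cmod (f r))\<^sup>2) * indicator {s<..t} r \<partial>half_line)
      * (\<integral>\<^sup>+r. ennreal ((cmod (P r k))\<^sup>2) * indicator {s<..t} r \<partial>half_line)"
proof -
  let ?D = "trunc_integral P f t k - trunc_integral P f s k"
  have "ennreal (cmod ?D) \<le> (\<integral>\<^sup>+r. ennreal (norm (indicator {s<..t} r *\<^sub>R (f r * P r k))) \<partial>half_line)"
    unfolding trunc_integral_diff(2)[where P=P and f=f and k=k, OF h st]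
    by (intro integral_norm_bound_ennreal trunc_integral_diff(1)[where P=P and f=f and k=k, OF h st])
  also have "\<dots> = (\<integral>\<^sup>+r. (ennreal (cmod (f r)) * indicator {s<..t} r) * (ennreal (cmod (P r k)) * indicator {s<..t} r) \<partial>half_line)"
    by (intro nn_integral_cong) (auto simp: norm_mult ennreal_mult split: split_indicator)
  finally have "(ennreal (cmod ?D))\<^sup>2 \<le> \<dots>\<^sup>2"
    by (rule power_mono) simp
  also have "\<dots> \<le> (\<integral>\<^sup>+r. (ennreal (cmod (f r)) * indicator {s<..t} r)\<^sup>2 \<partial>half_line)
      * (\<integral>\<^sup>+r. (ennreal (cmod (P r k)) * indicator {s<..t} r)\<^sup>2 \<partial>half_line)"
    by (rule Cauchy_Schwarz_nn_integral) measurable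
  also have "(\<lambda>r. (ennreal (cmod (f r)) * indicator {s<..t} r)\<^sup>2) = (\<lambda>r. ennreal ((cmod (f r))\<^sup>2) * indicator {s<..t} r)"
    by (auto simp: ennreal_power fun_eq_iff split: split_indicator)
  also have "(\<lambda>r. (ennreal (cmod (P r k)) * indicator {s<..t} r)\<^sup>2) = (\<lambda>r. ennreal ((cmod (P r k))\<^sup>2) * indicator {s<..t} r)"
    by (auto simp: ennreal_power fun_eq_iff split: split_indicator)
  finally show ?thesis by (simp add: ennreal_power)
qed

section \<open>Tails, unit cells and convergence along the reals\<close>

text \<open>Truncated integrals of \<open>tail s f\<close> are increments of those of
  \<open>f\<close> from time \<open>s\<close> on. Any statement about all admissible
  \<open>f\<close> thereby becomes one about increments.\<close>

definition tail :: "real \<Rightarrow> (real \<Rightarrow> complex) \<Rightarrow> real \<Rightarrow> complex" where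
  "tail s f r = indicator {s<..} r *\<^sub>R f r"

lemma tail_L2:
  assumes "f \<in> L2 half_line" shows "tail s f \<in> L2 half_line"
proof -
  have [measurable]: "f \<in> borel_measurable half_line" using assms by (auto simp: L2_def)
  have "(\<integral>\<^sup>+r. ennreal ((cmod (tail s f r))\<^sup>2) \<partial>half_line) \<le> (\<integral>\<^sup>+r. ennreal ((cmod (f r))\<^sup>2) \<partial>half_line)"
    by (intro nn_integral_mono) (auto simp: tail_def split: split_indicator)
  also have "\<dots> < \<infinity>" using assms by (auto simp: L2_def)
  finally show ?thesis by (auto simp: L2_def tail_def[abs_def])
qed

lemma trunc_integral_tail:
  assumes "loc_integrable (\<lambda>r. f r * P r k)" "0 \<le> s" "s \<le> t"
  shows "trunc_integral P (tail s f) t k = trunc_integral P f t k - trunc_integral P f s k"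
proof -
  have "indicator {0..t} r *\<^sub>R (tail s f r * P r k) = indicator {s<..t} r *\<^sub>R (f r * P r k)" for r
    using assms by (auto simp: tail_def split: split_indicator)
  then show ?thesis
    using trunc_integral_diff(2)[where P=P and f=f and k=k, OF assms] by (simp add: trunc_integral_eq)
qed

lemma sum_unit_cells:
  fixes g :: "real \<Rightarrow> ennreal"
  assumes g [measurable]: "g \<in> borel_measurable half_line" and ab: "a \<le> b"
  shows "(\<Sum>n\<in>{a..<b}. \<integral>\<^sup>+r. g r * indicator {real n<..real n + 1} r \<partial>half_line)
    = (\<integral>\<^sup>+r. g r * indicator {real a<..real b} r \<partial>half_line)"
  using ab
proof (induction rule: dec_induct)
  case (step n)
  then have "g r * indicator {real a<..real n} r + g r * indicator {real n<..real n + 1} r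
      = g r * indicator {real a<..real (Suc n)} r" for r
    by (auto split: split_indicator)
  with step show ?case
    by (simp add: nn_integral_add[symmetric])
qed simp

text \<open>The half-open cells are disjoint and cover every positive point.\<close>

lemma suminf_unit_cells_le:
  fixes g :: "real \<Rightarrow> ennreal"
  assumes g: "g \<in> borel_measurable half_line"
  shows "(\<Sum>n. \<integral>\<^sup>+r. g r * indicator {real n<..real n + 1} r \<partial>half_line) \<le> (\<integral>\<^sup>+r. g r \<partial>half_line)"
proof (rule suminf_le_const)
  fix N
  show "(\<Sum>n<N. \<integral>\<^sup>+r. g r * indicator {real n<..real n + 1} r \<partial>half_line) \<le> (\<integral>\<^sup>+r. g r \<partial>half_line)"
    unfolding lessThan_atLeast0 sum_unit_cells[OF g le0]
    by (intro nn_integral_mono) (auto split: split_indicator)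
qed simp

lemma tail_integral_tendsto_0:
  fixes g :: "real \<Rightarrow> ennreal"
  assumes [measurable]: "g \<in> borel_measurable half_line" and fin: "(\<integral>\<^sup>+r. g r \<partial>half_line) < \<infinity>"
  shows "((\<lambda>s. \<integral>\<^sup>+r. g r * indicator {s<..} r \<partial>half_line) \<longlongrightarrow> 0) at_top"
proof (rule tendsto_at_topI_sequentially)
  fix X :: "nat \<Rightarrow> real" assume X: "filterlim X at_top sequentially"
  have "(\<lambda>n. \<integral>\<^sup>+r. g r * indicator {X n<..} r \<partial>half_line) \<longlonglongrightarrow> (\<integral>\<^sup>+r. 0 \<partial>half_line)"
  proof (rule nn_integral_dominated_convergence[where w=g])
    show "AE r in half_line. (\<lambda>n. g r * indicator {X n<..} r) \<longlonglongrightarrow> 0"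
    proof (intro AE_I2 tendsto_eventually)
      fix r
      have "\<forall>\<^sub>F n in sequentially. r \<le> X n"
        using X by (simp add: filterlim_at_top)
      then show "\<forall>\<^sub>F n in sequentially. g r * indicator {X n<..} r = 0"
        by eventually_elim simp
    qed
  qed (use fin in \<open>auto split: split_indicator\<close>)
  then show "(\<lambda>n. \<integral>\<^sup>+r. g r * indicator {X n<..} r \<partial>half_line) \<longlonglongrightarrow> 0"
    by simp
qed

text \<open>One good \<open>n\<close> for each \<open>e\<close> suffices, since all later times are
  then close to \<open>T n\<close> and so to each other. This weak form is what a vanishing lower
  limit of majorants provides.\<close>

lemma convergent_at_top_if_tail_small:
  fixes T :: "real \<Rightarrow> 'a::banach"
  assumes "\<forall>e>0. \<exists>n::nat. \<forall>t>real n. norm (T t - T (real n)) < e"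
  shows "\<exists>l. (T \<longlongrightarrow> l) at_top"
proof -
  have small: "\<exists>n::nat. \<forall>t>real n. norm (T t - T (real n)) < e / 2" if "0 < e" for e
    using assms that half_gt_zero by blast
  have "Cauchy (\<lambda>n. T (real n))"
  proof (rule metric_CauchyI)
    fix e :: real assume "0 < e"
    from small[OF this] obtain n :: nat where n: "\<And>t. t > real n \<Longrightarrow> norm (T t - T (real n)) < e / 2" by auto
    have "dist (T (real n)) (T (real i)) < e / 2" if "Suc n \<le> i" for i
      unfolding dist_norm by (subst norm_minus_commute, rule n) (use that in simp)
    then have "dist (T (real i)) (T (real j)) < e" if "Suc n \<le> i" "Suc n \<le> j" for i j
      using that by (blast intro: dist_triangle_half_r)
    then show "\<exists>M. \<forall>i\<ge>M. \<forall>j\<ge>M. dist (T (real i)) (T (real j)) < e" by blast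
  qed
  then obtain l where l: "(\<lambda>n. T (real n)) \<longlonglongrightarrow> l"
    by (auto simp: Cauchy_convergent_iff convergent_def)
  have "(T \<longlongrightarrow> l) at_top"
  proof (rule tendstoI)
    fix e :: real assume "0 < e"
    from small[OF this] obtain n :: nat where n: "\<And>t. t > real n \<Longrightarrow> norm (T t - T (real n)) < e / 2" by auto
    have "(\<lambda>m. norm (T (real m) - T (real n))) \<longlonglongrightarrow> norm (l - T (real n))"
      by (intro tendsto_intros l)
    then have "norm (l - T (real n)) \<le> e / 2"
      by (rule LIMSEQ_le_const2) (intro exI[of _ "Suc n"] allI impI less_imp_le n, simp)
    then have "dist (T t) l < e" if "real n < t" for t
      using n[OF that] norm_triangle_ineq4[of "T t - T (real n)" "l - T (real n)"] by (simp add: dist_norm)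
    then show "\<forall>\<^sub>F t in at_top. dist (T t) l < e"
      unfolding eventually_at_top_dense by blast
  qed
  then show ?thesis ..
qed

subsection \<open>Orthonormal systems\<close>

context
  fixes P :: "real \<Rightarrow> real \<Rightarrow> complex" and \<sigma> :: "real measure"
  assumes sys: "continuous_orthonormal_system P \<sigma>"
begin

lemma sets_system: "sets \<sigma> = sets borel"
  using sys by (simp add: continuous_orthonormal_system_def)

lemma space_system: "space \<sigma> = UNIV"
  using sets_system sets_eq_imp_space_eq by fastforce

lemma measurable_system: "(\<lambda>(r, k). P r k) \<in> borel_measurable (half_line \<Otimes>\<^sub>M \<sigma>)"
  using sys by (simp add: continuous_orthonormal_system_def)

lemma AE_loc_integrable:
  assumes "f \<in> L2 half_line"
  shows "AE k in \<sigma>. loc_integrable (\<lambda>r. f r * P r k) \<and> (\<lambda>r. P r k) \<in> borel_measurable half_line"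
proof -
  have "AE k in \<sigma>. (\<lambda>r. P r k) \<in> L2_loc"
    using sys by (simp add: continuous_orthonormal_system_def)
  then show ?thesis
    by eventually_elim (auto intro: loc_integrable_mult assms simp: L2_loc_def)
qed

text \<open>Only the half-line, the variable integrated out, has to be
  \<open>\<sigma>\<close>-finite. The default value 0 of the integral makes the function measurable
  on the whole line, without exceptional points.\<close>

lemma borel_measurable_trunc_integral:
  assumes "f \<in> L2 half_line"
  shows "trunc_integral P f t \<in> borel_measurable \<sigma>"
proof -
  interpret sigma_finite_measure half_line by (rule sigma_finite_half_line)
  note [measurable] = measurable_system
  have [measurable]: "f \<in> borel_measurable half_line" using assms by (auto simp: L2_def)
  have "(\<lambda>k. LINT r|half_line. indicator {0..t} r *\<^sub>R (f r * P r k)) \<in> borel_measurable \<sigma>"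
  proof (rule borel_measurable_lebesgue_integral)
    have "(\<lambda>(r, k). indicator {0..t} r *\<^sub>R (f r * P r k)) \<in> borel_measurable (half_line \<Otimes>\<^sub>M \<sigma>)"
      by measurable
    from measurable_pair_swap[OF this]
    show "(\<lambda>(k, r). indicator {0..t} r *\<^sub>R (f r * P r k)) \<in> borel_measurable (\<sigma> \<Otimes>\<^sub>M half_line)"
      by (simp add: case_prod_beta)
  qed
  then show ?thesis by (simp add: trunc_integral_eq[abs_def])
qed

lemma trunc_integral_isometry:
  assumes f: "f \<in> L2 half_line" and st: "0 \<le> s" "s \<le> t"
  shows "(\<integral>\<^sup>+k. ennreal ((cmod (trunc_integral P f t k - trunc_integral P f s k))\<^sup>2) \<partial>\<sigma>)
    = (\<integral>\<^sup>+r. ennreal ((cmod (f r))\<^sup>2) * indicator {s<..t} r \<partial>half_line)"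
proof (cases "t = 0")
  \<comment> \<open>Condition (b) is available only for positive endpoints; here both sides
    vanish.\<close>
  case True
  with st have "s = 0" "{s<..t} = {}" by auto
  with True show ?thesis by simp
next
  case False
  have "(\<integral>\<^sup>+k. ennreal ((cmod (trunc_integral P f t k - trunc_integral P f s k))\<^sup>2) \<partial>\<sigma>)
      = (\<integral>\<^sup>+k. ennreal ((cmod (trunc_integral P (tail s f) t k))\<^sup>2) \<partial>\<sigma>)"
    using AE_loc_integrable[OF f]
    by (intro nn_integral_cong_AE) (auto simp: trunc_integral_tail st)
  also have "\<dots> = (\<integral>\<^sup>+r. ennreal ((cmod (tail s f r))\<^sup>2) \<partial>lebesgue_on {0..t})"
    using sys tail_L2[OF f] st False by (simp add: continuous_orthonormal_system_def)
  also have "\<dots> = (\<integral>\<^sup>+r. ennreal ((cmod (f r))\<^sup>2) * indicator {s<..t} r \<partial>half_line)"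
    unfolding nn_integral_lebesgue_on_interval using st
    by (intro nn_integral_cong) (auto simp: tail_def split: split_indicator)
  finally show ?thesis .
qed

lemma borel_measurable_section: "(\<lambda>r. P r k) \<in> borel_measurable half_line"
  using measurable_Pair1[OF measurable_system, of k] by (simp add: space_system)

section \<open>Tonelli and the maximal inequality\<close>

text \<open>Exchanging the integrals leaves for each \<open>r\<close> an inner integral over
  \<open>k\<close> that \<open>K\<close> bounds, and then the length of the interval. Restricting
  \<open>\<sigma>\<close> to \<open>S\<close> by a density is what permits the exchange.\<close>

lemma weighted_section_integral_le:
  fixes \<kappa> :: "real \<Rightarrow> real"
  assumes \<kappa>: "\<kappa> \<in> borel_measurable borel" "\<And>k. 0 < \<kappa> k"
    and S: "S \<in> sets \<sigma>" and sf: "sigma_finite_measure (density \<sigma> (indicator S))"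
    and K: "\<And>r. 0 \<le> r \<Longrightarrow> (\<integral>\<^sup>+k. ennreal ((cmod (P r k))\<^sup>2 / \<kappa> k) \<partial>\<sigma>) \<le> K"
    and st: "s \<le> t"
  shows "(\<integral>\<^sup>+k. (\<integral>\<^sup>+r. ennreal ((cmod (P r k))\<^sup>2) * indicator {s<..t} r \<partial>half_line)
            * ennreal (1 / \<kappa> k) * indicator S k \<partial>\<sigma>) \<le> ennreal (t - s) * K"
proof -
  let ?D = "density \<sigma> (indicator S)"
  interpret D: sigma_finite_measure ?D by (rule sf)
  interpret H: sigma_finite_measure half_line by (rule sigma_finite_half_line)
  interpret pair_sigma_finite half_line ?D ..
  note [measurable] = S borel_measurable_section
  have [measurable]: "\<kappa> \<in> borel_measurable \<sigma>"
    using \<kappa>(1) by (simp add: measurable_cong_sets[OF sets_system refl])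
  define g where "g = (\<lambda>r k. ennreal ((cmod (P r k))\<^sup>2) * indicator {s<..t} r * ennreal (1 / \<kappa> k))"
  have g: "case_prod g \<in> borel_measurable (half_line \<Otimes>\<^sub>M \<sigma>)"
  proof -
    note [measurable] = measurable_system
    have "(\<lambda>(r, k). ennreal ((cmod (P r k))\<^sup>2) * indicator {s<..t} r * ennreal (1 / \<kappa> k))
        \<in> borel_measurable (half_line \<Otimes>\<^sub>M \<sigma>)"
      by measurable
    then show ?thesis by (simp add: g_def)
  qed
  have gD: "case_prod g \<in> borel_measurable (half_line \<Otimes>\<^sub>M ?D)"
    using g by (subst measurable_cong_sets[OF sets_pair_measure_cong[OF refl sets_density] refl])
  have gr: "g r \<in> borel_measurable \<sigma>" if "0 \<le> r" for r
    using measurable_Pair2[OF g, of r] that by simp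
  have gk: "(\<lambda>k. \<integral>\<^sup>+r. g r k \<partial>half_line) \<in> borel_measurable \<sigma>"
    using measurable_pair_swap[OF g]
    by (intro H.borel_measurable_nn_integral) (simp add: case_prod_beta)
  have "(\<integral>\<^sup>+k. (\<integral>\<^sup>+r. ennreal ((cmod (P r k))\<^sup>2) * indicator {s<..t} r \<partial>half_line)
            * ennreal (1 / \<kappa> k) * indicator S k \<partial>\<sigma>)
      = (\<integral>\<^sup>+k. indicator S k * (\<integral>\<^sup>+r. g r k \<partial>half_line) \<partial>\<sigma>)"
  proof (intro nn_integral_cong)
    fix k
    have "(\<integral>\<^sup>+r. g r k \<partial>half_line)
        = (\<integral>\<^sup>+r. ennreal ((cmod (P r k))\<^sup>2) * indicator {s<..t} r \<partial>half_line) * ennreal (1 / \<kappa> k)"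
      unfolding g_def by (rule nn_integral_multc) measurable
    then show "(\<integral>\<^sup>+r. ennreal ((cmod (P r k))\<^sup>2) * indicator {s<..t} r \<partial>half_line)
            * ennreal (1 / \<kappa> k) * indicator S k = indicator S k * (\<integral>\<^sup>+r. g r k \<partial>half_line)"
      by (simp add: mult_ac)
  qed
  also have "\<dots> = (\<integral>\<^sup>+k. (\<integral>\<^sup>+r. g r k \<partial>half_line) \<partial>?D)"
    using gk by (subst nn_integral_density) auto
  also have "\<dots> = (\<integral>\<^sup>+r. (\<integral>\<^sup>+k. g r k \<partial>?D) \<partial>half_line)"
    by (rule Fubini'[OF gD])
  also have "\<dots> \<le> (\<integral>\<^sup>+r. indicator {s<..t} r * K \<partial>half_line)"
  proof (intro nn_integral_mono)
    fix r assume "r \<in> space half_line"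
    then have r: "0 \<le> r" by simp
    have "(\<integral>\<^sup>+k. g r k \<partial>?D) = (\<integral>\<^sup>+k. indicator S k * g r k \<partial>\<sigma>)"
      using gr[OF r] by (intro nn_integral_density) auto
    also have "\<dots> \<le> (\<integral>\<^sup>+k. indicator {s<..t} r * ennreal ((cmod (P r k))\<^sup>2 / \<kappa> k) \<partial>\<sigma>)"
      by (intro nn_integral_mono) (auto simp: g_def ennreal_mult[symmetric] less_imp_le[OF \<kappa>(2)] split: split_indicator)
    also have "\<dots> = indicator {s<..t} r * (\<integral>\<^sup>+k. ennreal ((cmod (P r k))\<^sup>2 / \<kappa> k) \<partial>\<sigma>)"
    proof (rule nn_integral_cmult)
      have [measurable]: "P r \<in> borel_measurable \<sigma>"
        using measurable_Pair2[OF measurable_system, of r] r by simp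
      show "(\<lambda>k. ennreal ((cmod (P r k))\<^sup>2 / \<kappa> k)) \<in> borel_measurable \<sigma>"
        by measurable
    qed
    also have "\<dots> \<le> indicator {s<..t} r * K"
      by (intro mult_left_mono K r) auto
    finally show "(\<integral>\<^sup>+k. g r k \<partial>?D) \<le> indicator {s<..t} r * K" .
  qed
  also have "\<dots> = (\<integral>\<^sup>+r. indicator {s<..t} r \<partial>half_line) * K"
    by (rule nn_integral_multc) measurable
  \<comment> \<open>Only an inequality, because \<open>s\<close> may be negative.\<close>
  also have "(\<integral>\<^sup>+r. indicator {s<..t} r \<partial>half_line) \<le> (\<integral>\<^sup>+r. indicator {s<..t} r \<partial>lebesgue)"
    by (subst nn_integral_restrict_space, simp, intro nn_integral_mono) (auto split: split_indicator)
  also have "(\<integral>\<^sup>+r. indicator {s<..t} r \<partial>lebesgue) = ennreal (t - s)"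
    using st by (subst nn_integral_indicator) auto
  finally show ?thesis by (simp add: mult_right_mono)
qed

text \<open>
  The supremum over \<open>t\<close> need not be measurable, hence the measurable majorant \<open>H\<close>: a null lower
  integral of a nonmeasurable function would not make it vanish almost everywhere.
\<close>

lemma maximal_majorant:
  fixes \<kappa> :: "real \<Rightarrow> real"
  assumes f: "f \<in> L2 half_line"
    and \<kappa>: "\<kappa> \<in> borel_measurable borel" "\<And>k. 0 < \<kappa> k"
    and L: "\<And>k. ennreal (1 / \<kappa> k) \<le> L"
    and K: "\<And>r. 0 \<le> r \<Longrightarrow> (\<integral>\<^sup>+k. ennreal ((cmod (P r k))\<^sup>2 / \<kappa> k) \<partial>\<sigma>) \<le> K"
  obtains H where "H \<in> borel_measurable \<sigma>"
    and "AE k in \<sigma>. \<forall>t>0. ennreal ((cmod (trunc_integral P f t k))\<^sup>2) * ennreal (1 / \<kappa> k) \<le> H k"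
    and "(\<integral>\<^sup>+k. H k \<partial>\<sigma>)
      \<le> 288 * (L + K) * (\<integral>\<^sup>+r. ennreal ((cmod (f r))\<^sup>2 * (ln (2 + r))\<^sup>2) \<partial>half_line)"
proof -
  interpret H: sigma_finite_measure half_line by (rule sigma_finite_half_line)
  have f_meas [measurable]: "f \<in> borel_measurable half_line" using f by (auto simp: L2_def)
  note [measurable] = borel_measurable_trunc_integral[OF f] borel_measurable_section
  have [measurable]: "\<kappa> \<in> borel_measurable \<sigma>"
    using \<kappa>(1) by (simp add: measurable_cong_sets[OF sets_system refl])
  define T where "T t k = trunc_integral P f t k" for t k
  have T [measurable]: "T t \<in> borel_measurable \<sigma>" for t
    unfolding T_def[abs_def] by measurable
  define A where "A n = (\<integral>\<^sup>+r. ennreal ((cmod (f r))\<^sup>2) * indicator {real n<..real n + 1} r \<partial>half_line)" for n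
  define p where "p n k = (\<integral>\<^sup>+r. ennreal ((cmod (P r k))\<^sup>2) * indicator {real n<..real n + 1} r \<partial>half_line)" for n k
  define W where "W = (\<integral>\<^sup>+r. ennreal ((cmod (f r))\<^sup>2 * (ln (2 + r))\<^sup>2) \<partial>half_line)"
  \<comment> \<open>By (b) each \<open>T q\<close> is square integrable, so this countable union of
    supports is \<open>\<sigma>\<close>-finite. By continuity all \<open>T t\<close> vanish at
    almost every \<open>k\<close> outside it.\<close>
  define S where "S = (\<Union>q\<in>\<rat> \<inter> {0<..}. {k\<in>space \<sigma>. ennreal ((cmod (T q k))\<^sup>2) \<noteq> 0})"
  have p [measurable]: "p n \<in> borel_measurable \<sigma>" for n
  proof -
    note [measurable] = measurable_system
    have "(\<lambda>(r, k). ennreal ((cmod (P r k))\<^sup>2) * indicator {real n<..real n + 1} r)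
        \<in> borel_measurable (half_line \<Otimes>\<^sub>M \<sigma>)"
      by measurable
    from measurable_pair_swap[OF this] show ?thesis
      unfolding p_def[abs_def] by (intro H.borel_measurable_nn_integral) (simp add: case_prod_beta)
  qed
  have countable_I: "countable (\<rat> \<inter> {0<..} :: real set)"
    using countable_rat by blast
  have S [measurable]: "S \<in> sets \<sigma>"
    unfolding S_def using countable_I by (intro sets.countable_UN'') measurable
  have iso: "(\<integral>\<^sup>+k. ennreal ((cmod (T t k - T s k))\<^sup>2) \<partial>\<sigma>)
      = (\<integral>\<^sup>+r. ennreal ((cmod (f r))\<^sup>2) * indicator {s<..t} r \<partial>half_line)" if "0 \<le> s" "s \<le> t" for s t
    unfolding T_def by (rule trunc_integral_isometry[OF f that])
  have T0: "T 0 k = 0" for k by (simp add: T_def trunc_integral_0)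
  have sf: "sigma_finite_measure (density \<sigma> (indicator S))"
    unfolding S_def
  proof (rule sigma_finite_density_support[OF countable_I])
    fix q :: real assume q: "q \<in> \<rat> \<inter> {0<..}"
    have "(\<integral>\<^sup>+k. ennreal ((cmod (T q k))\<^sup>2) \<partial>\<sigma>) \<le> (\<integral>\<^sup>+r. ennreal ((cmod (f r))\<^sup>2) \<partial>half_line)"
      using iso[of 0 q] q by (auto simp: T0 intro!: nn_integral_mono split: split_indicator)
    also have "\<dots> < \<infinity>" using f by (auto simp: L2_def)
    finally show "(\<integral>\<^sup>+k. ennreal ((cmod (T q k))\<^sup>2) \<partial>\<sigma>) < \<infinity>" .
  qed measurable
  have A_ln: "(\<Sum>n. A n * ennreal ((ln (2 + real n))\<^sup>2)) \<le> W"
  proof -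
    have "A n * ennreal ((ln (2 + real n))\<^sup>2)
        \<le> (\<integral>\<^sup>+r. ennreal ((cmod (f r))\<^sup>2 * (ln (2 + r))\<^sup>2) * indicator {real n<..real n + 1} r \<partial>half_line)" for n
    proof -
      have "A n * ennreal ((ln (2 + real n))\<^sup>2) = (\<integral>\<^sup>+r. ennreal ((cmod (f r))\<^sup>2)
          * indicator {real n<..real n + 1} r * ennreal ((ln (2 + real n))\<^sup>2) \<partial>half_line)"
        unfolding A_def by (rule nn_integral_multc[symmetric]) measurable
      also have "\<dots> \<le> (\<integral>\<^sup>+r. ennreal ((cmod (f r))\<^sup>2 * (ln (2 + r))\<^sup>2) * indicator {real n<..real n + 1} r \<partial>half_line)"
        by (intro nn_integral_mono)
           (auto simp: ennreal_mult[symmetric] split: split_indicator intro!: ennreal_leI mult_left_mono power_mono)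
      finally show ?thesis .
    qed
    then have "(\<Sum>n. A n * ennreal ((ln (2 + real n))\<^sup>2)) \<le> (\<Sum>n. \<integral>\<^sup>+r. ennreal ((cmod (f r))\<^sup>2 * (ln (2 + r))\<^sup>2) * indicator {real n<..real n + 1} r \<partial>half_line)"
      by (intro suminf_le) auto
    also have "\<dots> \<le> W"
      unfolding W_def by (intro suminf_unit_cells_le) measurable
    finally show ?thesis .
  qed
  have A_W: "(\<Sum>n. A n) \<le> 3 * W"
  proof -
    have "1 \<le> 3 * ennreal ((ln (2 + real n))\<^sup>2)" for n
    proof -
      have "2 / 3 \<le> ln (2 + real n)"
        using ln2_ge_two_thirds by (rule order_trans) simp
      from power_mono[OF this, of 2] have "1 \<le> 3 * (ln (2 + real n))\<^sup>2"
        by (simp add: power2_eq_square)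
      from ennreal_leI[OF this] show ?thesis by (simp add: ennreal_mult)
    qed
    from mult_left_mono[OF this, of "A _"]
    have "(\<Sum>n. A n) \<le> (\<Sum>n. 3 * (A n * ennreal ((ln (2 + real n))\<^sup>2)))"
      by (intro suminf_le) (auto simp: mult_ac)
    also have "\<dots> = 3 * (\<Sum>n. A n * ennreal ((ln (2 + real n))\<^sup>2))" by (rule ennreal_suminf_cmult)
    also have "\<dots> \<le> 3 * W" by (intro mult_left_mono A_ln) auto
    finally show ?thesis .
  qed

  \<comment> \<open>\<open>H1\<close> controls the integer times and is integrated using
    \<open>1 / \<kappa> \<le> L\<close>; \<open>H2 n\<close> controls the passage from
    \<open>n\<close> into the next cell and is integrated using \<open>K\<close>. The sum over
    \<open>n\<close> below replaces a supremum over \<open>n\<close>.\<close>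
  define H1 where "H1 k = rm_majorant (\<lambda>n. T (real n) k) * ennreal (1 / \<kappa> k)" for k
  define H2 where "H2 n k = A n * (p n k * ennreal (1 / \<kappa> k) * indicator S k)" for n k
  have [measurable]: "H1 \<in> borel_measurable \<sigma>"
    unfolding H1_def by measurable
  have [measurable]: "H2 n \<in> borel_measurable \<sigma>" for n
    unfolding H2_def by measurable
  have H1: "(\<integral>\<^sup>+k. H1 k \<partial>\<sigma>) \<le> 144 * L * W"
  proof -
    have "(\<integral>\<^sup>+k. H1 k \<partial>\<sigma>) \<le> (\<integral>\<^sup>+k. rm_majorant (\<lambda>n. T (real n) k) * L \<partial>\<sigma>)"
      unfolding H1_def by (intro nn_integral_mono mult_left_mono L) auto
    also have "\<dots> = (\<integral>\<^sup>+k. rm_majorant (\<lambda>n. T (real n) k) \<partial>\<sigma>) * L"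
      by (rule nn_integral_multc) measurable
    also have "(\<integral>\<^sup>+k. rm_majorant (\<lambda>n. T (real n) k) \<partial>\<sigma>) \<le> 144 * (\<Sum>n. A n * ennreal ((ln (2 + real n))\<^sup>2))"
    proof (rule rm_majorant_bound)
      fix a b :: nat assume "a \<le> b"
      then show "(\<integral>\<^sup>+k. ennreal ((cmod (T (real b) k - T (real a) k))\<^sup>2) \<partial>\<sigma>) \<le> (\<Sum>n\<in>{a..<b}. A n)"
        unfolding A_def by (subst iso) (auto simp: sum_unit_cells)
    qed (simp_all add: T0)
    also have "144 * (\<Sum>n. A n * ennreal ((ln (2 + real n))\<^sup>2)) * L \<le> 144 * W * L"
      by (intro mult_right_mono mult_left_mono A_ln) auto
    finally show ?thesis by (simp add: mult_ac mult_right_mono)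
  qed
  have H2: "(\<integral>\<^sup>+k. H2 n k \<partial>\<sigma>) \<le> A n * K" for n
  proof -
    have "(\<integral>\<^sup>+k. H2 n k \<partial>\<sigma>) = A n * (\<integral>\<^sup>+k. p n k * ennreal (1 / \<kappa> k) * indicator S k \<partial>\<sigma>)"
      unfolding H2_def by (rule nn_integral_cmult) measurable
    also have "\<dots> \<le> A n * (ennreal ((real n + 1) - real n) * K)"
      unfolding p_def by (intro mult_left_mono weighted_section_integral_le \<kappa> S sf K) auto
    finally show ?thesis by simp
  qed
  show ?thesis
  proof
    show "(\<lambda>k. 2 * H1 k + 2 * (\<Sum>n. H2 n k)) \<in> borel_measurable \<sigma>"
      by measurable
    have "(\<integral>\<^sup>+k. 2 * H1 k + 2 * (\<Sum>n. H2 n k) \<partial>\<sigma>) = 2 * (\<integral>\<^sup>+k. H1 k \<partial>\<sigma>) + 2 * (\<Sum>n. \<integral>\<^sup>+k. H2 n k \<partial>\<sigma>)"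
      by (simp add: nn_integral_add nn_integral_cmult nn_integral_suminf)
    also have "\<dots> \<le> 2 * (144 * L * W) + 2 * (\<Sum>n. A n * K)"
      by (intro add_mono mult_left_mono H1 suminf_le H2) auto
    also have "(\<Sum>n. A n * K) = (\<Sum>n. A n) * K"
      by (rule ennreal_suminf_multc)
    also have "2 * (144 * L * W) + 2 * ((\<Sum>n. A n) * K) \<le> 2 * (144 * L * W) + 2 * (3 * W * K)"
      by (intro add_mono mult_left_mono mult_right_mono A_W) auto
    \<comment> \<open>The 288 is \<open>2 * 144\<close>; the smaller constant 6 is then raised to it
      to obtain the common factor \<open>L + K\<close>.\<close>
    also have "\<dots> = 288 * (L * W) + 6 * (K * W)"
    proof -
      have "2 * (144 * L * W) = 288 * (L * W)" "2 * (3 * W * K) = 6 * (W * K)"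
        by (simp_all add: mult.assoc[symmetric])
      then show ?thesis by (simp only: mult.commute[of W K])
    qed
    also have "\<dots> \<le> 288 * (L * W) + 288 * (K * W)"
      by (intro add_mono mult_right_mono) auto
    also have "\<dots> = 288 * (L + K) * W"
      by (simp only: distrib_left distrib_right mult.assoc)
    finally show "(\<integral>\<^sup>+k. 2 * H1 k + 2 * (\<Sum>n. H2 n k) \<partial>\<sigma>)
        \<le> 288 * (L + K) * (\<integral>\<^sup>+r. ennreal ((cmod (f r))\<^sup>2 * (ln (2 + r))\<^sup>2) \<partial>half_line)"
      unfolding W_def .
    show "AE k in \<sigma>. \<forall>t>0. ennreal ((cmod (trunc_integral P f t k))\<^sup>2) * ennreal (1 / \<kappa> k)
        \<le> 2 * H1 k + 2 * (\<Sum>n. H2 n k)"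
      using AE_loc_integrable[OF f]
    proof eventually_elim
      case (elim k)
      then have loc: "loc_integrable (\<lambda>r. f r * P r k)" by simp
      show ?case
      proof (intro allI impI)
        fix t :: real assume t: "0 < t"
        show "ennreal ((cmod (trunc_integral P f t k))\<^sup>2) * ennreal (1 / \<kappa> k) \<le> 2 * H1 k + 2 * (\<Sum>n. H2 n k)"
        proof (cases "k \<in> S")
          case False
          then have "trunc_integral P f q k = 0" if "q \<in> \<rat>" "0 < q" for q
            using that by (auto simp: S_def T_def space_system)
          from trunc_integral_eq_0_if_rat[where P=P and f=f and k=k, OF loc this t]
          show ?thesis by simp
        next
          case True
          \<comment> \<open>The ceiling minus one, not the floor, puts \<open>t\<close> into the
            half-open cell \<open>{n<..n + 1}\<close>.\<close>
          define n where "n = nat (\<lceil>t\<rceil> - 1)"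
          have "real n = of_int \<lceil>t\<rceil> - 1"
            using t by (simp add: n_def)
          then have n: "real n \<le> t" "t \<le> real n + 1"
            by linarith+
          have "(cmod (T t k))\<^sup>2 = (cmod (T n k + (T t k - T n k)))\<^sup>2" by simp
          also have "\<dots> \<le> 2 * ((cmod (T n k))\<^sup>2 + (cmod (T t k - T n k))\<^sup>2)"
            using norm_add_sq_le_weighted[of 1 "T n k" "T t k - T n k"] by simp
          finally have "ennreal ((cmod (T t k))\<^sup>2)
              \<le> 2 * (ennreal ((cmod (T n k))\<^sup>2) + ennreal ((cmod (T t k - T n k))\<^sup>2))"
            using ennreal_leI by (fastforce simp: ennreal_mult)
          also have "\<dots> \<le> 2 * (rm_majorant (\<lambda>n. T (real n) k) + A n * p n k)"
          proof (intro mult_left_mono add_mono)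
            show "ennreal ((cmod (T n k))\<^sup>2) \<le> rm_majorant (\<lambda>n. T (real n) k)"
              by (rule sq_le_rm_majorant[where T="\<lambda>n. T (real n) k"]) (simp add: T0)
            have "ennreal ((cmod (T t k - T n k))\<^sup>2)
              \<le> (\<integral>\<^sup>+r. ennreal ((cmod (f r))\<^sup>2) * indicator {real n<..t} r \<partial>half_line)
              * (\<integral>\<^sup>+r. ennreal ((cmod (P r k))\<^sup>2) * indicator {real n<..t} r \<partial>half_line)"
              unfolding T_def using n by (intro trunc_integral_diff_sq_le loc) auto
            also have "\<dots> \<le> A n * p n k"
              unfolding A_def p_def using n
              by (intro mult_mono nn_integral_mono) (auto split: split_indicator)
            finally show "ennreal ((cmod (T t k - T n k))\<^sup>2) \<le> A n * p n k" .
          qed auto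
          finally have "ennreal ((cmod (T t k))\<^sup>2) * ennreal (1 / \<kappa> k)
              \<le> 2 * (rm_majorant (\<lambda>n. T (real n) k) + A n * p n k) * ennreal (1 / \<kappa> k)"
            by (rule mult_right_mono) simp
          also have "\<dots> = 2 * H1 k + 2 * H2 n k"
            using True by (simp add: H1_def H2_def distrib_left distrib_right mult_ac)
          also have "\<dots> \<le> 2 * H1 k + 2 * (\<Sum>n. H2 n k)"
            using sum_le_suminf[of "\<lambda>n. H2 n k" "{n}"] by (intro add_mono mult_left_mono) auto
          finally show ?thesis by (simp add: T_def)
        qed
      qed
    qed
  qed
qed

section \<open>Almost everywhere convergence\<close>

text \<open>The majorants for the tails of \<open>f\<close> have integrals tending to 0. By Fatou
  their lower limit vanishes almost everywhere, so for each \<open>e\<close> some tail has a small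
  maximal function at \<open>k\<close>.\<close>

lemma AE_trunc_integral_Cauchy:
  fixes \<kappa> :: "real \<Rightarrow> real"
  assumes f: "f \<in> L2 half_line"
    and W_fin: "(\<integral>\<^sup>+r. ennreal ((cmod (f r))\<^sup>2 * (ln (2 + r))\<^sup>2) \<partial>half_line) < \<infinity>"
    and \<kappa>: "\<kappa> \<in> borel_measurable borel" "\<And>k. 0 < \<kappa> k"
    and L: "\<And>k. ennreal (1 / \<kappa> k) \<le> L" "L < \<infinity>"
    and K: "\<And>r. 0 \<le> r \<Longrightarrow> (\<integral>\<^sup>+k. ennreal ((cmod (P r k))\<^sup>2 / \<kappa> k) \<partial>\<sigma>) \<le> K" "K < \<infinity>"
  shows "AE k in \<sigma>. \<forall>e>0. \<exists>n::nat. \<forall>t>real n.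
    cmod (trunc_integral P f t k - trunc_integral P f (real n) k) < e"
proof -
  have [measurable]: "f \<in> borel_measurable half_line" using f by (auto simp: L2_def)
  define w where "w r = ennreal ((cmod (f r))\<^sup>2 * (ln (2 + r))\<^sup>2)" for r
  have w [measurable]: "w \<in> borel_measurable half_line"
    unfolding w_def by measurable
  define W where "W s = (\<integral>\<^sup>+r. w r * indicator {s<..} r \<partial>half_line)" for s
  have W_tail: "(\<integral>\<^sup>+r. ennreal ((cmod (tail s f r))\<^sup>2 * (ln (2 + r))\<^sup>2) \<partial>half_line) = W s" for s
    unfolding W_def w_def by (intro nn_integral_cong) (auto simp: tail_def split: split_indicator)
  have "\<exists>H. \<forall>n. H n \<in> borel_measurable \<sigma> \<and>
      (AE k in \<sigma>. \<forall>t>0. ennreal ((cmod (trunc_integral P (tail (real n) f) t k))\<^sup>2) * ennreal (1 / \<kappa> k) \<le> H n k) \<and>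
      (\<integral>\<^sup>+k. H n k \<partial>\<sigma>) \<le> 288 * (L + K) * W (real n)"
  proof (intro choice allI)
    fix n :: nat
    show "\<exists>H. H \<in> borel_measurable \<sigma> \<and>
      (AE k in \<sigma>. \<forall>t>0. ennreal ((cmod (trunc_integral P (tail (real n) f) t k))\<^sup>2) * ennreal (1 / \<kappa> k) \<le> H k) \<and>
      (\<integral>\<^sup>+k. H k \<partial>\<sigma>) \<le> 288 * (L + K) * W (real n)"
      by (rule maximal_majorant[OF tail_L2[OF f] \<kappa> L(1) K(1), of "real n"]) (auto simp: W_tail)
  qed
  then obtain H where "\<forall>n. H n \<in> borel_measurable \<sigma> \<and>
      (AE k in \<sigma>. \<forall>t>0. ennreal ((cmod (trunc_integral P (tail (real n) f) t k))\<^sup>2) * ennreal (1 / \<kappa> k) \<le> H n k) \<and>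
      (\<integral>\<^sup>+k. H n k \<partial>\<sigma>) \<le> 288 * (L + K) * W (real n)" ..
  from spec[OF this] have H [measurable]: "H n \<in> borel_measurable \<sigma>"
    and H_ge: "AE k in \<sigma>. \<forall>t>0. ennreal ((cmod (trunc_integral P (tail (real n) f) t k))\<^sup>2) * ennreal (1 / \<kappa> k) \<le> H n k"
    and H_int: "(\<integral>\<^sup>+k. H n k \<partial>\<sigma>) \<le> 288 * (L + K) * W (real n)" for n
    by blast+
  have "(\<lambda>n. W (real n)) \<longlonglongrightarrow> 0"
    unfolding W_def using tail_integral_tendsto_0[OF w W_fin[folded w_def]]
    by (rule filterlim_compose) (rule filterlim_real_sequentially)
  \<comment> \<open>In \<open>ennreal\<close>, multiplication by a constant preserves this limit
    because \<open>L\<close> and \<open>K\<close> are finite.\<close>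
  then have "(\<lambda>n. 288 * (L + K) * W (real n)) \<longlonglongrightarrow> 288 * (L + K) * 0"
    using L(2) K(2) by (intro ennreal_tendsto_cmult) (auto simp: ennreal_mult_less_top)
  then have "liminf (\<lambda>n. 288 * (L + K) * W (real n)) = 0"
    by (simp add: lim_imp_Liminf)
  moreover have "(\<integral>\<^sup>+k. liminf (\<lambda>n. H n k) \<partial>\<sigma>) \<le> liminf (\<lambda>n. \<integral>\<^sup>+k. H n k \<partial>\<sigma>)"
    by (rule nn_integral_liminf) measurable
  moreover have "liminf (\<lambda>n. \<integral>\<^sup>+k. H n k \<partial>\<sigma>) \<le> liminf (\<lambda>n. 288 * (L + K) * W (real n))"
    by (intro Liminf_mono always_eventually allI H_int)
  ultimately have "(\<integral>\<^sup>+k. liminf (\<lambda>n. H n k) \<partial>\<sigma>) = 0"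
    by auto
  then have "AE k in \<sigma>. liminf (\<lambda>n. H n k) = 0"
    by (subst (asm) nn_integral_0_iff_AE) auto
  moreover have "AE k in \<sigma>. \<forall>n. \<forall>t>0.
      ennreal ((cmod (trunc_integral P (tail (real n) f) t k))\<^sup>2) * ennreal (1 / \<kappa> k) \<le> H n k"
    using H_ge by (simp add: AE_all_countable)
  ultimately show ?thesis
    using AE_loc_integrable[OF f]
  proof eventually_elim
    case (elim k)
    show ?case
    proof (intro allI impI)
      fix e :: real assume e: "0 < e"
      \<comment> \<open>The majorant carries the weight \<open>1 / \<kappa> k\<close>, so the
        threshold carries it too and it cancels at the end.\<close>
      have "\<exists>n. H n k < ennreal (e\<^sup>2 / \<kappa> k)"
      proof (rule ccontr)
        assume "\<not> ?thesis"
        then have "ennreal (e\<^sup>2 / \<kappa> k) \<le> liminf (\<lambda>n. H n k)"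
          by (intro Liminf_bounded) (auto simp: not_less)
        then show False using elim(1) e \<kappa>(2)[of k] by (simp add: ennreal_eq_0_iff zero_less_divide_iff divide_le_0_iff)
      qed
      then obtain n where n: "H n k < ennreal (e\<^sup>2 / \<kappa> k)" ..
      have "cmod (trunc_integral P f t k - trunc_integral P f (real n) k) < e" if t: "real n < t" for t
      proof -
        let ?D = "trunc_integral P f t k - trunc_integral P f (real n) k"
        have "0 < t" using t by (rule le_less_trans[rotated]) simp
        have "?D = trunc_integral P (tail (real n) f) t k"
          using elim(3) t by (subst trunc_integral_tail) auto
        with elim(2) \<open>0 < t\<close> have "ennreal ((cmod ?D)\<^sup>2) * ennreal (1 / \<kappa> k) \<le> H n k"
          by simp
        also note n
        finally have "ennreal ((cmod ?D)\<^sup>2 / \<kappa> k) < ennreal (e\<^sup>2 / \<kappa> k)"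
          using \<kappa>(2)[of k] by (simp add: ennreal_mult[symmetric])
        then have "(cmod ?D)\<^sup>2 / \<kappa> k < e\<^sup>2 / \<kappa> k"
          using \<kappa>(2)[of k] by (simp add: ennreal_less_iff)
        then have "(cmod ?D)\<^sup>2 < e\<^sup>2"
          using \<kappa>(2)[of k] by (simp add: divide_less_cancel)
        then show ?thesis using e by (simp add: power_less_imp_less_base)
      qed
      then show "\<exists>n::nat. \<forall>t>real n. cmod (trunc_integral P f t k - trunc_integral P f (real n) k) < e"
        by blast
    qed
  qed
qed

section \<open>The limit in the square mean\<close>

text \<open>Fatou applied to the increments from \<open>R\<close> to \<open>n\<close>, as
  \<open>n\<close> grows, bounds the squared distance of \<open>g\<close> from the truncated
  integral at \<open>R\<close> by the energy of \<open>f\<close> beyond \<open>R\<close>. The case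
  \<open>R = 0\<close> shows that \<open>g\<close> is square integrable.\<close>

lemma represents_full_integral_limit:
  assumes f: "f \<in> L2 half_line"
    and g: "g \<in> borel_measurable \<sigma>"
    and lim: "AE k in \<sigma>. ((\<lambda>R. trunc_integral P f R k) \<longlongrightarrow> g k) at_top"
  shows "represents_full_integral P \<sigma> f g"
proof -
  note [measurable] = borel_measurable_trunc_integral[OF f] g
  have [measurable]: "f \<in> borel_measurable half_line" using f by (auto simp: L2_def)
  let ?T = "trunc_integral P f"
  define E where "E s = (\<integral>\<^sup>+r. ennreal ((cmod (f r))\<^sup>2) * indicator {s<..} r \<partial>half_line)" for s
  have bound: "(\<integral>\<^sup>+k. ennreal ((cmod (?T R k - g k))\<^sup>2) \<partial>\<sigma>) \<le> E R" if R: "0 \<le> R" for R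
  proof -
    have "(\<integral>\<^sup>+k. ennreal ((cmod (?T R k - g k))\<^sup>2) \<partial>\<sigma>)
        \<le> (\<integral>\<^sup>+k. liminf (\<lambda>n. ennreal ((cmod (?T (real n) k - ?T R k))\<^sup>2)) \<partial>\<sigma>)"
    proof (intro nn_integral_mono_AE)
      show "AE k in \<sigma>. ennreal ((cmod (?T R k - g k))\<^sup>2)
          \<le> liminf (\<lambda>n. ennreal ((cmod (?T (real n) k - ?T R k))\<^sup>2))"
        using lim
      proof eventually_elim
        case (elim k)
        from filterlim_compose[OF elim filterlim_real_sequentially]
        have "(\<lambda>n. ?T (real n) k) \<longlonglongrightarrow> g k" .
        then have "(\<lambda>n. ennreal ((cmod (?T (real n) k - ?T R k))\<^sup>2)) \<longlonglongrightarrow> ennreal ((cmod (g k - ?T R k))\<^sup>2)"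
          by (intro tendsto_intros)
        from lim_imp_Liminf[OF sequentially_bot this] show ?case
          by (subst norm_minus_commute) simp
      qed
    qed
    also have "\<dots> \<le> liminf (\<lambda>n. \<integral>\<^sup>+k. ennreal ((cmod (?T (real n) k - ?T R k))\<^sup>2) \<partial>\<sigma>)"
      by (rule nn_integral_liminf) measurable
    also have "\<dots> \<le> liminf (\<lambda>n::nat. E R)"
    proof (rule Liminf_mono)
      show "\<forall>\<^sub>F n in sequentially. (\<integral>\<^sup>+k. ennreal ((cmod (?T (real n) k - ?T R k))\<^sup>2) \<partial>\<sigma>) \<le> E R"
        using eventually_ge_at_top[of "nat \<lceil>R\<rceil>"]
      proof eventually_elim
        case (elim n)
        then have "R \<le> real n" by linarith
        then show ?case unfolding E_def
          by (subst trunc_integral_isometry[OF f R]) (auto intro!: nn_integral_mono split: split_indicator)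
      qed
    qed
    also have "\<dots> = E R" by (simp add: Liminf_const)
    finally show ?thesis .
  qed
  have "(\<integral>\<^sup>+k. ennreal ((cmod (g k))\<^sup>2) \<partial>\<sigma>) \<le> E 0"
    using bound[of 0] by (simp add: trunc_integral_0)
  also have "\<dots> \<le> (\<integral>\<^sup>+r. ennreal ((cmod (f r))\<^sup>2) \<partial>half_line)"
    unfolding E_def by (intro nn_integral_mono) (auto split: split_indicator)
  also have "\<dots> < \<infinity>" using f by (auto simp: L2_def)
  finally have "g \<in> L2 \<sigma>" using g by (simp add: L2_def)
  moreover have "((\<lambda>R. \<integral>\<^sup>+k. ennreal ((cmod (?T R k - g k))\<^sup>2) \<partial>\<sigma>) \<longlongrightarrow> 0) at_top"
  proof (rule tendsto_sandwich[where f="\<lambda>_. 0" and h=E])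
    show "(E \<longlongrightarrow> 0) at_top"
      unfolding E_def[abs_def] using f by (intro tail_integral_tendsto_0) (auto simp: L2_def)
    show "\<forall>\<^sub>F R in at_top. (\<integral>\<^sup>+k. ennreal ((cmod (?T R k - g k))\<^sup>2) \<partial>\<sigma>) \<le> E R"
      using eventually_ge_at_top[of 0] by eventually_elim (rule bound)
  qed auto
  ultimately show ?thesis by (simp add: represents_full_integral_def)
qed

text \<open>The pointwise limit is one representative; uniqueness carries the almost everywhere
  convergence over to every other one.\<close>

lemma represents_full_integral_unique:
  assumes f: "f \<in> L2 half_line"
    and g: "represents_full_integral P \<sigma> f g" "represents_full_integral P \<sigma> f h"
  shows "AE k in \<sigma>. g k = h k"
proof -
  note [measurable] = borel_measurable_trunc_integral[OF f]
  have [measurable]: "g \<in> borel_measurable \<sigma>" "h \<in> borel_measurable \<sigma>"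
    using g by (auto simp: represents_full_integral_def L2_def)
  let ?T = "trunc_integral P f"
  define D where "D u R = (\<integral>\<^sup>+k. ennreal ((cmod (?T R k - u k))\<^sup>2) \<partial>\<sigma>)" for u R
  have "(\<integral>\<^sup>+k. ennreal ((cmod (g k - h k))\<^sup>2) \<partial>\<sigma>) \<le> 2 * D g R + 2 * D h R" for R
  proof -
    have "(\<integral>\<^sup>+k. ennreal ((cmod (g k - h k))\<^sup>2) \<partial>\<sigma>)
      \<le> (\<integral>\<^sup>+k. 2 * ennreal ((cmod (?T R k - g k))\<^sup>2) + 2 * ennreal ((cmod (?T R k - h k))\<^sup>2) \<partial>\<sigma>)"
    proof (intro nn_integral_mono)
      fix k
      have "(cmod (g k - h k))\<^sup>2 \<le> 2 * ((cmod (g k - ?T R k))\<^sup>2 + (cmod (?T R k - h k))\<^sup>2)"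
        using norm_add_sq_le_weighted[of 1 "g k - ?T R k" "?T R k - h k"] by simp
      then have "ennreal ((cmod (g k - h k))\<^sup>2) \<le> ennreal (2 * (cmod (?T R k - g k))\<^sup>2 + 2 * (cmod (?T R k - h k))\<^sup>2)"
        by (intro ennreal_leI) (simp add: norm_minus_commute)
      then show "ennreal ((cmod (g k - h k))\<^sup>2) \<le> 2 * ennreal ((cmod (?T R k - g k))\<^sup>2) + 2 * ennreal ((cmod (?T R k - h k))\<^sup>2)"
        by (simp add: ennreal_mult)
    qed
    also have "\<dots> = 2 * D g R + 2 * D h R"
      unfolding D_def by (simp add: nn_integral_add nn_integral_cmult)
    finally show ?thesis .
  qed
  moreover have "((\<lambda>R. 2 * D g R + 2 * D h R) \<longlongrightarrow> 2 * 0 + 2 * 0) at_top"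
    using g unfolding D_def
    by (intro tendsto_add ennreal_tendsto_cmult) (auto simp: represents_full_integral_def)
  ultimately have "(\<integral>\<^sup>+k. ennreal ((cmod (g k - h k))\<^sup>2) \<partial>\<sigma>) \<le> 2 * 0 + 2 * 0"
    by (intro tendsto_lowerbound[where F=at_top] always_eventually) auto
  then have "(\<integral>\<^sup>+k. ennreal ((cmod (g k - h k))\<^sup>2) \<partial>\<sigma>) = 0" by simp
  then show ?thesis by (subst (asm) nn_integral_0_iff_AE) auto
qed

end

subsection \<open>Normalized systems\<close>

text \<open>The essential supremum refers to Lebesgue measure, to which \<open>\<sigma>\<close> may
  be singular, so a bound at every point is needed. By continuity the set where the bound holds is
  closed, and a closed set of full Lebesgue measure is the whole line.\<close>

lemma inverse_le_Linf_norm: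
  fixes \<kappa> :: "real \<Rightarrow> real"
  assumes cont: "continuous_on UNIV \<kappa>" and pos: "\<And>k. 0 < \<kappa> k"
  shows "ennreal (1 / \<kappa> k) \<le> Linf_norm (\<lambda>k. 1 / \<kappa> k)"
proof (cases "Linf_norm (\<lambda>k. 1 / \<kappa> k)")
  case (real l)
  have "AE x in lborel. ennreal \<bar>1 / \<kappa> x\<bar> \<le> ennreal l"
    using esssup_AE[where M=lborel and f="\<lambda>x. ennreal \<bar>1 / \<kappa> x\<bar>"] real by (simp add: Linf_norm_def)
  then have "AE x in lebesgue. ennreal \<bar>1 / \<kappa> x\<bar> \<le> ennreal l"
    by (rule AE_completion)
  then have "AE x in lebesgue. x \<in> {x. 1 / \<kappa> x \<le> l}"
    by eventually_elim (use real in \<open>simp add: ennreal_le_iff abs_of_pos[OF pos]\<close>)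
  moreover have "closed {x. 1 / \<kappa> x \<le> l}"
    using pos by (intro closed_Collect_le continuous_intros cont) (auto simp: less_imp_neq[symmetric])
  ultimately have "k \<in> {x. 1 / \<kappa> x \<le> l}"
    by (intro mem_closed_if_AE_lebesgue)
  then show ?thesis using real by (simp add: ennreal_leI)
qed simp

text \<open>On the half-line \<open>ln (2 + r) \<ge> 2/3\<close>, so the weight can be divided out,
  both for measurability and for the norm; the factor 3 works because
  \<open>3 * (2/3)\<^sup>2 \<ge> 1\<close>.\<close>

lemma L2_if_ln_weighted:
  assumes "(\<lambda>r. f r * of_real (ln (2 + r))) \<in> L2 half_line"
  shows "f \<in> L2 half_line"
proof -
  let ?g = "\<lambda>r. f r * complex_of_real (ln (2 + r))"
  have g [measurable]: "?g \<in> borel_measurable half_line" using assms by (auto simp: L2_def)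
  have "(\<lambda>r. complex_of_real (ln (2 + r))) \<in> borel_measurable half_line"
    by measurable
  with g have "(\<lambda>r. ?g r / complex_of_real (ln (2 + r))) \<in> borel_measurable half_line"
    by (rule borel_measurable_divide)
  then have [measurable]: "f \<in> borel_measurable half_line"
    by (subst measurable_cong[of _ f "\<lambda>r. ?g r / complex_of_real (ln (2 + r))"]) auto
  have "(\<integral>\<^sup>+r. ennreal ((cmod (f r))\<^sup>2) \<partial>half_line) \<le> (\<integral>\<^sup>+r. 3 * ennreal ((cmod (?g r))\<^sup>2) \<partial>half_line)"
  proof (intro nn_integral_mono)
    fix r assume "r \<in> space half_line"
    then have "2 / 3 \<le> ln (2 + r)"
      using ln2_ge_two_thirds by (intro order_trans[OF ln2_ge_two_thirds]) simp
    from power_mono[OF this, of 2] have "1 \<le> 3 * (ln (2 + r))\<^sup>2"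
      by (simp add: power2_eq_square)
    then have "(cmod (f r))\<^sup>2 * 1 \<le> (cmod (f r))\<^sup>2 * (3 * (ln (2 + r))\<^sup>2)"
      by (intro mult_left_mono) auto
    then have "(cmod (f r))\<^sup>2 \<le> 3 * (cmod (?g r))\<^sup>2"
      by (simp add: norm_mult power_mult_distrib mult_ac)
    from ennreal_leI[OF this] show "ennreal ((cmod (f r))\<^sup>2) \<le> 3 * ennreal ((cmod (?g r))\<^sup>2)"
      by (simp add: ennreal_mult)
  qed
  also have "\<dots> = 3 * (\<integral>\<^sup>+r. ennreal ((cmod (?g r))\<^sup>2) \<partial>half_line)"
    by (rule nn_integral_cmult) measurable
  also have "\<dots> < \<infinity>" using assms by (simp add: L2_def ennreal_mult_less_top)
  finally show ?thesis by (simp add: L2_def)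
qed

theorem theorem1p3:
  shows "\<exists>C::real. 0 < C \<and>
    (\<forall>(P :: real \<Rightarrow> real \<Rightarrow> complex) (\<sigma> :: real measure) (\<kappa> :: real \<Rightarrow> real) (f :: real \<Rightarrow> complex).
       normalized_continuous_orthonormal_system P \<sigma> \<kappa> \<longrightarrow>
       (\<lambda>r. f r * of_real (ln (2 + r))) \<in> L2 (lebesgue_on {0..}) \<longrightarrow>
         (\<integral>\<^sup>+k. (\<Squnion>t\<in>{0<..}. ennreal ((cmod (trunc_integral P f t k))\<^sup>2)) * ennreal (1 / \<kappa> k) \<partial>\<sigma>)
           \<le> ennreal C * (Linf_norm (\<lambda>k. 1 / \<kappa> k) + system_constant P \<sigma> \<kappa>)
               * (\<integral>\<^sup>+r. ennreal ((cmod (f r))\<^sup>2 * (ln (2 + r))\<^sup>2) \<partial>lebesgue_on {0..})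
         \<and> (\<exists>g. represents_full_integral P \<sigma> f g)
         \<and> (\<forall>g. represents_full_integral P \<sigma> f g \<longrightarrow>
               (AE k in \<sigma>. ((\<lambda>R. trunc_integral P f R k) \<longlongrightarrow> g k) at_top)))"
proof (intro exI[of _ 288] conjI allI impI)
  fix P :: "real \<Rightarrow> real \<Rightarrow> complex" and \<sigma> :: "real measure" and \<kappa> :: "real \<Rightarrow> real" and f :: "real \<Rightarrow> complex"
  assume nsys: "normalized_continuous_orthonormal_system P \<sigma> \<kappa>"
    and f_ln: "(\<lambda>r. f r * of_real (ln (2 + r))) \<in> L2 (lebesgue_on {0..})"
  let ?T = "trunc_integral P f"
  let ?L = "Linf_norm (\<lambda>k. 1 / \<kappa> k)" and ?K = "system_constant P \<sigma> \<kappa>"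
  let ?W = "\<integral>\<^sup>+r. ennreal ((cmod (f r))\<^sup>2 * (ln (2 + r))\<^sup>2) \<partial>half_line"
  have sys: "continuous_orthonormal_system P \<sigma>" and cont: "continuous_on UNIV \<kappa>"
    and pos: "\<And>k. 0 < \<kappa> k" and fin: "?L < \<infinity>" "?K < \<infinity>"
    using nsys by (auto simp: normalized_continuous_orthonormal_system_def)
  have \<kappa>: "\<kappa> \<in> borel_measurable borel"
    using cont by (rule borel_measurable_continuous_onI)
  have L: "ennreal (1 / \<kappa> k) \<le> ?L" for k
    using inverse_le_Linf_norm[OF cont pos] .
  have K: "(\<integral>\<^sup>+k. ennreal ((cmod (P r k))\<^sup>2 / \<kappa> k) \<partial>\<sigma>) \<le> ?K" if "0 \<le> r" for r
    unfolding system_constant_def using that by (intro SUP_upper) auto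
  have f: "f \<in> L2 half_line" using L2_if_ln_weighted[OF f_ln] .
  have W: "?W < \<infinity>"
    using f_ln by (simp add: L2_def norm_mult power_mult_distrib)
  show "(\<integral>\<^sup>+k. (\<Squnion>t\<in>{0<..}. ennreal ((cmod (?T t k))\<^sup>2)) * ennreal (1 / \<kappa> k) \<partial>\<sigma>)
      \<le> ennreal 288 * (?L + ?K) * ?W"
  proof -
    obtain H where "H \<in> borel_measurable \<sigma>" and H: "AE k in \<sigma>. \<forall>t>0. ennreal ((cmod (?T t k))\<^sup>2) * ennreal (1 / \<kappa> k) \<le> H k"
      "(\<integral>\<^sup>+k. H k \<partial>\<sigma>) \<le> 288 * (?L + ?K) * ?W"
      by (rule maximal_majorant[OF sys f \<kappa> pos L K])
    have "(\<integral>\<^sup>+k. (\<Squnion>t\<in>{0<..}. ennreal ((cmod (?T t k))\<^sup>2)) * ennreal (1 / \<kappa> k) \<partial>\<sigma>) \<le> (\<integral>\<^sup>+k. H k \<partial>\<sigma>)"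
    proof (rule nn_integral_mono_AE)
      show "AE k in \<sigma>. (\<Squnion>t\<in>{0<..}. ennreal ((cmod (?T t k))\<^sup>2)) * ennreal (1 / \<kappa> k) \<le> H k"
        using H(1) by eventually_elim (auto simp: SUP_mult_right_ennreal intro!: SUP_least)
    qed
    with H(2) show ?thesis by simp
  qed
  \<comment> \<open>A limit along the integers is measurable in \<open>k\<close>. Where it does not
    exist \<open>lim\<close> is an unspecified value, but this happens only on a null set.\<close>
  define g where "g k = lim (\<lambda>n. ?T (real n) k)" for k
  have "g \<in> borel_measurable \<sigma>"
    unfolding g_def by (intro borel_measurable_lim_metric borel_measurable_trunc_integral[OF sys f])
  moreover have "AE k in \<sigma>. \<forall>e>0. \<exists>n::nat. \<forall>t>real n. cmod (?T t k - ?T (real n) k) < e"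
    by (rule AE_trunc_integral_Cauchy[OF sys f W \<kappa> pos L fin(1) K fin(2)])
  then have g_lim: "AE k in \<sigma>. ((\<lambda>R. ?T R k) \<longlongrightarrow> g k) at_top"
  proof eventually_elim
    case (elim k)
    from convergent_at_top_if_tail_small[OF elim]
    obtain l where l: "((\<lambda>R. ?T R k) \<longlongrightarrow> l) at_top" ..
    from filterlim_compose[OF this filterlim_real_sequentially]
    have "g k = l" unfolding g_def by (rule limI)
    with l show ?case by simp
  qed
  ultimately have g: "represents_full_integral P \<sigma> f g"
    by (rule represents_full_integral_limit[OF sys f])
  then show "\<exists>g. represents_full_integral P \<sigma> f g" by blast
  fix h assume h: "represents_full_integral P \<sigma> f h"
  show "AE k in \<sigma>. ((\<lambda>R. ?T R k) \<longlongrightarrow> h k) at_top"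
    using represents_full_integral_unique[OF sys f g h] g_lim by eventually_elim simp
qed simp

end
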